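(* Let $G$ be an infinite compact abelian group with dual group $\varGamma$ and let $\varLambda \subset \varGamma$. If $\varLambda$ is a Rosenthal set, then the quotient space $C(G)/C_\varLambda(G)$ has the Daugavet property.
   Context: $\varGamma$ is the (discrete) group of continuous homomorphisms $G \to \mathbb T$; $m$ is the normalized Haar measure on $G$; function spaces are complex-valued and $C(G)$ carries the sup norm. $\hat f(\gamma) = \int_G f\overline\gamma\,dm$. $C_\varLambda(G)$ (resp. $L^\infty_\varLambda(G)$) is the set of $f$ in $C(G)$ (resp. $L^\infty(G,m)$) with $\hat f(\gamma) = 0$ for all $\gamma \in \varGamma\setminus\varLambda$. $\varLambda$ is a Rosenthal set if every equivalence class in $L^\infty_\varLambda(G)$ contains a continuous member, i.e. $L^\infty_\varLambda(G) = C_\varLambda(G)$. A Banach space $X$ has the Daugavet property if every bounded rank-one operator $T: X \to X$ satisfies $\|\mathrm{Id}+T\| = 1 + \|T\|$. *)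

theory Defs
  imports "HOL-Analysis.Analysis"
begin

section \<open>Complex normed spaces on a carrier set\<close>

text \<open>The quotient \<open>C(G)/C\<^sub>\<Lambda>(G)\<close> depends on the set \<open>\<Lambda>\<close> and so is not a type;
  normed spaces are therefore records with an explicit carrier.\<close>

record 'v normed_struct =
  vcarrier :: "'v set"
  vadd :: "'v \<Rightarrow> 'v \<Rightarrow> 'v"
  vzero :: "'v"
  vscale :: "complex \<Rightarrow> 'v \<Rightarrow> 'v"
  vnorm :: "'v \<Rightarrow> real"

definition vdiff :: "'v normed_struct \<Rightarrow> 'v \<Rightarrow> 'v \<Rightarrow> 'v" where
  "vdiff X x y = vadd X x (vscale X (-1) y)"

locale complex_normed_space =
  fixes X :: "'v normed_struct"
  assumes add_closed: "\<lbrakk>x \<in> vcarrier X; y \<in> vcarrier X\<rbrakk> \<Longrightarrow> vadd X x y \<in> vcarrier X"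
    and zero_closed: "vzero X \<in> vcarrier X"
    and scale_closed: "x \<in> vcarrier X \<Longrightarrow> vscale X c x \<in> vcarrier X"
    and add_assoc: "\<lbrakk>x \<in> vcarrier X; y \<in> vcarrier X; z \<in> vcarrier X\<rbrakk>
      \<Longrightarrow> vadd X (vadd X x y) z = vadd X x (vadd X y z)"
    and add_commute: "\<lbrakk>x \<in> vcarrier X; y \<in> vcarrier X\<rbrakk> \<Longrightarrow> vadd X x y = vadd X y x"
    and add_zero: "x \<in> vcarrier X \<Longrightarrow> vadd X x (vzero X) = x"
    and diff_self: "x \<in> vcarrier X \<Longrightarrow> vdiff X x x = vzero X"
    and scale_add_right: "\<lbrakk>x \<in> vcarrier X; y \<in> vcarrier X\<rbrakk>
      \<Longrightarrow> vscale X c (vadd X x y) = vadd X (vscale X c x) (vscale X c y)"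
    and scale_add_left: "x \<in> vcarrier X
      \<Longrightarrow> vscale X (c + d) x = vadd X (vscale X c x) (vscale X d x)"
    and scale_scale: "x \<in> vcarrier X \<Longrightarrow> vscale X c (vscale X d x) = vscale X (c * d) x"
    and scale_one: "x \<in> vcarrier X \<Longrightarrow> vscale X 1 x = x"
    and norm_nonneg: "x \<in> vcarrier X \<Longrightarrow> 0 \<le> vnorm X x"
    and norm_eq_zero: "x \<in> vcarrier X \<Longrightarrow> vnorm X x = 0 \<longleftrightarrow> x = vzero X"
    and norm_triangle: "\<lbrakk>x \<in> vcarrier X; y \<in> vcarrier X\<rbrakk>
      \<Longrightarrow> vnorm X (vadd X x y) \<le> vnorm X x + vnorm X y"
    and norm_scale: "x \<in> vcarrier X \<Longrightarrow> vnorm X (vscale X c x) = cmod c * vnorm X x"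

locale complex_banach_space = complex_normed_space +
  assumes complete:
    "\<lbrakk>\<And>n. s n \<in> vcarrier X;
      \<And>e. e > 0 \<Longrightarrow> \<exists>N. \<forall>m\<ge>N. \<forall>n\<ge>N. vnorm X (vdiff X (s m) (s n)) < e\<rbrakk>
      \<Longrightarrow> \<exists>l\<in>vcarrier X. (\<lambda>n. vnorm X (vdiff X (s n) l)) \<longlonglongrightarrow> 0"


section \<open>The Daugavet property\<close>

text \<open>Operators are functions on the type \<open>'v\<close>; only their values on the carrier matter.\<close>

definition bounded_op :: "'v normed_struct \<Rightarrow> ('v \<Rightarrow> 'v) \<Rightarrow> bool" where
  "bounded_op X T \<longleftrightarrow>
     (\<forall>x\<in>vcarrier X. T x \<in> vcarrier X) \<and>
     (\<forall>x\<in>vcarrier X. \<forall>y\<in>vcarrier X. T (vadd X x y) = vadd X (T x) (T y)) \<and>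
     (\<forall>c. \<forall>x\<in>vcarrier X. T (vscale X c x) = vscale X c (T x)) \<and>
     (\<exists>K. \<forall>x\<in>vcarrier X. vnorm X (T x) \<le> K * vnorm X x)"

definition rank_one :: "'v normed_struct \<Rightarrow> ('v \<Rightarrow> 'v) \<Rightarrow> bool" where
  "rank_one X T \<longleftrightarrow>
     (\<exists>y\<in>vcarrier X. y \<noteq> vzero X \<and> T ` vcarrier X = range (\<lambda>c. vscale X c y))"

definition op_norm :: "'v normed_struct \<Rightarrow> ('v \<Rightarrow> 'v) \<Rightarrow> real" where
  "op_norm X T = (SUP x\<in>{x \<in> vcarrier X. vnorm X x \<le> 1}. vnorm X (T x))"

definition daugavet_property :: "'v normed_struct \<Rightarrow> bool" where
  "daugavet_property X \<longleftrightarrow> complex_banach_space X \<and>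
     (\<forall>T. bounded_op X T \<and> rank_one X T \<longrightarrow>
        op_norm X (\<lambda>x. vadd X x (T x)) = 1 + op_norm X T)"


section \<open>Quotient spaces\<close>

definition vcoset :: "'v normed_struct \<Rightarrow> 'v set \<Rightarrow> 'v \<Rightarrow> 'v set" where
  "vcoset X M x = vadd X x ` M"

text \<open>In the scalar product the summand from \<open>M\<close> matters for \<open>c = 0\<close>, where
  \<open>{c A}\<close> alone would be \<open>{0}\<close> instead of the zero coset \<open>M\<close>.\<close>

definition quotient_space :: "'v normed_struct \<Rightarrow> 'v set \<Rightarrow> 'v set normed_struct" where
  "quotient_space X M =
     \<lparr>vcarrier = vcoset X M ` vcarrier X,
      vadd = (\<lambda>A B. {vadd X a b | a b. a \<in> A \<and> b \<in> B}),
      vzero = M,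
      vscale = (\<lambda>c A. {vadd X (vscale X c a) y | a y. a \<in> A \<and> y \<in> M}),
      vnorm = (\<lambda>A. INF a\<in>A. vnorm X a)\<rparr>"


section \<open>Harmonic analysis on a compact abelian group\<close>

text \<open>The group is a type of class \<open>topological_ab_group_add\<close>, written additively.
  As it is compact, \<open>C(G)\<close> is the library type of bounded continuous functions with
  its supremum norm; the library only provides real scalars.\<close>

definition scaleC_bcontfun ::
  "complex \<Rightarrow> ('a::topological_space \<Rightarrow>\<^sub>C complex) \<Rightarrow> ('a \<Rightarrow>\<^sub>C complex)" where
  "scaleC_bcontfun c f = Bcontfun (\<lambda>x. c * apply_bcontfun f x)"

lemma scaleC_bcontfun_apply [simp]:
  "apply_bcontfun (scaleC_bcontfun c f) x = c * apply_bcontfun f x"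
proof -
  have "continuous_on UNIV (\<lambda>x. c * apply_bcontfun f x)"
    by (intro continuous_intros continuous_on_apply_bcontfun)
  then have "(\<lambda>x. c * apply_bcontfun f x) \<in> bcontfun"
    by (rule bcontfun_normI[where b = "cmod c * norm f"])
      (simp add: norm_mult mult_left_mono norm_bounded)
  then show ?thesis
    unfolding scaleC_bcontfun_def by (simp add: Bcontfun_inverse)
qed

definition C_space :: "('a::topological_space \<Rightarrow>\<^sub>C complex) normed_struct" where
  "C_space = \<lparr>vcarrier = UNIV, vadd = (+), vzero = 0, vscale = scaleC_bcontfun, vnorm = norm\<rparr>"

definition dual_group :: "('a::topological_ab_group_add \<Rightarrow> complex) set" where
  "dual_group = {\<gamma>. continuous_on UNIV \<gamma> \<and> (\<forall>x. cmod (\<gamma> x) = 1) \<and>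
                    (\<forall>x y. \<gamma> (x + y) = \<gamma> x * \<gamma> y)}"

text \<open>The group need not be second countable, so regularity has to be required. Outer
  regularity follows from inner regularity by complementation, the measure being finite.\<close>

definition normalized_haar_measure :: "'a::topological_ab_group_add measure \<Rightarrow> bool" where
  "normalized_haar_measure m \<longleftrightarrow>
     sets m = sets borel \<and>
     emeasure m UNIV = 1 \<and>
     (\<forall>a. distr m borel (\<lambda>x. a + x) = m) \<and>
     (\<forall>A\<in>sets borel. emeasure m A = (SUP K\<in>{K. K \<subseteq> A \<and> compact K}. emeasure m K))"

definition fourier_coeff ::
  "'a measure \<Rightarrow> ('a \<Rightarrow> complex) \<Rightarrow> ('a \<Rightarrow> complex) \<Rightarrow> complex" where
  "fourier_coeff m f \<gamma> = (\<integral>x. f x * cnj (\<gamma> x) \<partial>m)"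

definition C_spec ::
  "'a::topological_ab_group_add measure \<Rightarrow> ('a \<Rightarrow> complex) set \<Rightarrow> ('a \<Rightarrow>\<^sub>C complex) set" where
  "C_spec m \<Lambda> =
     {f. \<forall>\<gamma>\<in>dual_group - \<Lambda>. fourier_coeff m (apply_bcontfun f) \<gamma> = 0}"

text \<open>\<open>L\<^sup>\<infinity>\<close> is represented by functions rather than by classes modulo null sets.\<close>

definition Linfty :: "'a measure \<Rightarrow> ('a \<Rightarrow> complex) set" where
  "Linfty m = {f \<in> borel_measurable m. \<exists>K::real. AE x in m. cmod (f x) \<le> K}"

definition Linfty_spec ::
  "'a::topological_ab_group_add measure \<Rightarrow> ('a \<Rightarrow> complex) set \<Rightarrow> ('a \<Rightarrow> complex) set" where
  "Linfty_spec m \<Lambda> =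
     {f \<in> Linfty m. \<forall>\<gamma>\<in>dual_group - \<Lambda>. fourier_coeff m f \<gamma> = 0}"

definition rosenthal_set ::
  "'a::topological_ab_group_add measure \<Rightarrow> ('a \<Rightarrow> complex) set \<Rightarrow> bool" where
  "rosenthal_set m \<Lambda> \<longleftrightarrow>
     (\<forall>f\<in>Linfty_spec m \<Lambda>. \<exists>g. continuous_on UNIV g \<and> (AE x in m. f x = g x))"

end

theory Submission
  imports Defs
begin

text \<open>Put \<open>M = C\<^sub>\<Lambda>(G)\<close>. By the Hahn-Banach theorem, the duality of \<open>L\<^sup>1\<close> and \<open>L\<^sup>\<infinity>\<close>, and the Rosenthal property,
  the distance of a bounded function \<open>f\<close> to \<open>M\<close> is the supremum of \<open>\<bar>\<integral>gf\<bar>\<close> over the continuous \<open>g\<close> with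
  \<open>\<integral>\<bar>g\<bar> \<le> 1\<close> that annihilate \<open>L\<^sup>\<infinity>\<^sub>\<Lambda>\<close>. Let \<open>T = \<phi> \<otimes> [y]\<close>, let \<open>x\<^sub>0\<close> be in the unit ball of \<open>C(G)\<close>, and let \<open>g\<close>
  nearly norm \<open>[z]\<close>, where \<open>z = \<phi>(x\<^sub>0) y\<close>. The functional \<open>\<phi>\<close> has small variation on some dense open set \<open>U\<close>,
  so replacing \<open>x\<^sub>0\<close> on \<open>U\<close> by the conjugate sign of \<open>g\<close> hardly changes \<open>\<phi>(x\<^sub>0)\<close>. The resulting bounded function \<open>Y\<close>
  satisfies \<open>\<parallel>Y + z + h\<parallel> \<ge> 1 + \<parallel>[z]\<parallel> - \<epsilon>\<close> for all \<open>h \<in> M\<close>: a continuous function with positive mean is positive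
  somewhere on \<open>U\<close>. A second application of the distance formula gives a single \<open>g'\<close> that witnesses this for all
  \<open>h\<close> simultaneously, and hence also for the continuous approximations of \<open>Y\<close>.\<close>

section \<open>Extension of functionals on \<open>L\<^sup>1\<close>\<close>

text \<open>The norming function \<open>g\<close> must be continuous and not merely in L1:
  \<open>U\<close> is open and dense but can have small measure (it does when \<open>\<phi>\<close>
  is integration against \<open>m\<close>), so only an open set of positivity is sure to meet it.
  The Rosenthal property supplies such functions, because it turns the difference between
  \<open>f\<close> and a bounded extension \<open>k\<close> into a continuous function.

  The second obstacle is uniformity in \<open>h\<close>. For a single \<open>h\<close>, a continuous
  finite-stage cutoff would do, but the stage depends on \<open>h\<close>, and \<open>M\<close> may
  be infinite-dimensional. Hence the limit \<open>Y\<close> of all stages is taken first. It is only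
  Borel, which is why the distance formula is needed for bounded measurable functions and with
  almost-everywhere bounds. Once one \<open>g'\<close> serves all \<open>h\<close>, dominated
  convergence selects one stage.

  Infinitude of \<open>G\<close> enters through the absence of isolated points: every nonempty open
  set splits into two disjoint open pieces, and a bounded functional cannot be large on both at
  every scale.\<close>

text \<open>The functions \<open>'a \<Rightarrow> 'b\<close> are not an instance of \<open>real_vector\<close>, hence the pointwise operations. Zorn's
  lemma is applied to graphs of dominated linear extensions; a linear relation below \<open>p\<close> is automatically
  single-valued.\<close>

lemma hahn_banach_fun:
  fixes V W :: "('a \<Rightarrow> 'b::real_vector) set" and p f :: "('a \<Rightarrow> 'b) \<Rightarrow> real"
  assumes V_add: "\<And>u v. u \<in> V \<Longrightarrow> v \<in> V \<Longrightarrow> (\<lambda>x. u x + v x) \<in> V"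
    and V_scale: "\<And>r u. u \<in> V \<Longrightarrow> (\<lambda>x. r *\<^sub>R u x) \<in> V"
    and W_add: "\<And>u v. u \<in> W \<Longrightarrow> v \<in> W \<Longrightarrow> (\<lambda>x. u x + v x) \<in> W"
    and W_scale: "\<And>r u. u \<in> W \<Longrightarrow> (\<lambda>x. r *\<^sub>R u x) \<in> W"
    and WV: "W \<subseteq> V" and W_ne: "W \<noteq> {}"
    and p_add: "\<And>u v. u \<in> V \<Longrightarrow> v \<in> V \<Longrightarrow> p (\<lambda>x. u x + v x) \<le> p u + p v"
    and p_scale: "\<And>r u. r > 0 \<Longrightarrow> u \<in> V \<Longrightarrow> p (\<lambda>x. r *\<^sub>R u x) = r * p u"
    and p_zero: "p (\<lambda>x. 0) = 0"
    and f_add: "\<And>u v. u \<in> W \<Longrightarrow> v \<in> W \<Longrightarrow> f (\<lambda>x. u x + v x) = f u + f v"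
    and f_scale: "\<And>r u. u \<in> W \<Longrightarrow> f (\<lambda>x. r *\<^sub>R u x) = r * f u"
    and f_le: "\<And>u. u \<in> W \<Longrightarrow> f u \<le> p u"
  obtains F where "\<And>u v. u \<in> V \<Longrightarrow> v \<in> V \<Longrightarrow> F (\<lambda>x. u x + v x) = F u + F v"
    and "\<And>r u. u \<in> V \<Longrightarrow> F (\<lambda>x. r *\<^sub>R u x) = r * F u"
    and "\<And>u. u \<in> W \<Longrightarrow> F u = f u"
    and "\<And>u. u \<in> V \<Longrightarrow> F u \<le> p u"
proof -
  define lin where "lin G \<longleftrightarrow> (\<forall>u s v t. (u, s) \<in> G \<longrightarrow> (v, t) \<in> G \<longrightarrow> ((\<lambda>x. u x + v x), s + t) \<in> G) \<and>
      (\<forall>r u s. (u, s) \<in> G \<longrightarrow> ((\<lambda>x. r *\<^sub>R u x), r * s) \<in> G)" for G :: "(('a \<Rightarrow> 'b) \<times> real) set"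
  define G0 where "G0 = (\<lambda>u. (u, f u)) ` W"
  define \<G> where "\<G> = {G. lin G \<and> G0 \<subseteq> G \<and> (\<forall>u s. (u, s) \<in> G \<longrightarrow> u \<in> V \<and> s \<le> p u)}"
  have G0: "G0 \<in> \<G>"
    unfolding \<G>_def G0_def lin_def using W_add W_scale WV f_add f_scale f_le
    by (auto simp: image_iff)
  have "\<exists>G\<in>\<G>. \<forall>X\<in>\<G>. G \<subseteq> X \<longrightarrow> X = G"
  proof (rule subset_Zorn_nonempty)
    fix C assume ne: "C \<noteq> {}" and ch: "subset.chain \<G> C"
    have sub: "C \<subseteq> \<G>" and tot: "\<And>X Y. X \<in> C \<Longrightarrow> Y \<in> C \<Longrightarrow> X \<subseteq> Y \<or> Y \<subseteq> X"
      using ch unfolding subset_chain_def by auto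
    have "lin (\<Union>C)"
      unfolding lin_def
    proof (intro conjI allI impI)
      fix u s v t assume "(u, s) \<in> \<Union>C" "(v, t) \<in> \<Union>C"
      then obtain X Y where XY: "X \<in> C" "Y \<in> C" "(u, s) \<in> X" "(v, t) \<in> Y" by blast
      then obtain Z where "Z \<in> C" "(u, s) \<in> Z" "(v, t) \<in> Z" using tot by blast
      moreover from this have "lin Z" using sub unfolding \<G>_def by blast
      ultimately show "((\<lambda>x. u x + v x), s + t) \<in> \<Union>C" unfolding lin_def by blast
    next
      fix r u s assume "(u, s) \<in> \<Union>C"
      then obtain X where "X \<in> C" "(u, s) \<in> X" by blast
      moreover from this have "lin X" using sub unfolding \<G>_def by blast
      ultimately show "((\<lambda>x. r *\<^sub>R u x), r * s) \<in> \<Union>C" unfolding lin_def by blast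
    qed
    then show "\<Union>C \<in> \<G>" using ne sub unfolding \<G>_def by blast
  qed (use G0 in auto)
  then obtain G where G: "G \<in> \<G>" and max: "\<And>X. X \<in> \<G> \<Longrightarrow> G \<subseteq> X \<Longrightarrow> X = G" by blast
  have Gadd: "\<And>u s v t. (u, s) \<in> G \<Longrightarrow> (v, t) \<in> G \<Longrightarrow> ((\<lambda>x. u x + v x), s + t) \<in> G"
    and Gscale: "\<And>r u s. (u, s) \<in> G \<Longrightarrow> ((\<lambda>x. r *\<^sub>R u x), r * s) \<in> G"
    and GV: "\<And>u s. (u, s) \<in> G \<Longrightarrow> u \<in> V" and Gp: "\<And>u s. (u, s) \<in> G \<Longrightarrow> s \<le> p u"
    and G0G: "G0 \<subseteq> G"
    using G unfolding \<G>_def lin_def by blast+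
  have G_zero: "((\<lambda>x. 0), 0) \<in> G"
  proof -
    obtain w where "w \<in> W" using W_ne by blast
    then have "(w, f w) \<in> G" using G0G unfolding G0_def by blast
    from Gscale[OF this, of 0] show ?thesis by simp
  qed
  have G_fun: "s = t" if "(u, s) \<in> G" "(u, t) \<in> G" for u s t
  proof -
    \<comment> \<open>Subtraction puts \<open>s - t\<close> over the zero function, where
      \<open>p\<close> vanishes; domination then gives single-valuedness.\<close>
    have le: "s \<le> t" if "(u, s) \<in> G" "(u, t) \<in> G" for s t
    proof -
      have "((\<lambda>x. u x + (-1) *\<^sub>R u x), s + (-1) * t) \<in> G" by (intro Gadd Gscale that)
      then have "((\<lambda>x. 0), s - t) \<in> G" by simp
      from Gp[OF this] show ?thesis using p_zero by simp
    qed
    then show ?thesis using that by (meson antisym)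
  qed
  have dom: "\<exists>s. (v0, s) \<in> G" if v0: "v0 \<in> V" for v0
  proof -
    have V_diff: "(\<lambda>x. u x - v0 x) \<in> V" if "u \<in> V" for u
      using V_add[OF that V_scale[OF v0, of "-1"]] by simp
    \<comment> \<open>Any number between the bounds in \<open>lo\<close> and those in
      \<open>up\<close> could be the value at \<open>v0\<close>; \<open>sep\<close> shows that the
      two families do not cross.\<close>
    define c where "c = (SUP (u, s)\<in>G. s - p (\<lambda>x. u x - v0 x))"
    have sep: "s - p (\<lambda>x. u x - v0 x) \<le> p (\<lambda>x. v x + v0 x) - t"
      if "(u, s) \<in> G" "(v, t) \<in> G" for u s v t
    proof -
      have "s + t \<le> p (\<lambda>x. u x + v x)" using Gp[OF Gadd[OF that]] .
      also have "(\<lambda>x. u x + v x) = (\<lambda>x. (u x - v0 x) + (v x + v0 x))" by auto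
      also have "p \<dots> \<le> p (\<lambda>x. u x - v0 x) + p (\<lambda>x. v x + v0 x)"
        using that by (intro p_add V_diff V_add v0 GV)
      finally show ?thesis by simp
    qed
    have up: "t + c \<le> p (\<lambda>x. v x + v0 x)" if "(v, t) \<in> G" for v t
    proof -
      have "c \<le> p (\<lambda>x. v x + v0 x) - t"
        unfolding c_def using that sep G_zero by (intro cSUP_least) auto
      then show ?thesis by simp
    qed
    have lo: "s - c \<le> p (\<lambda>x. u x - v0 x)" if us: "(u, s) \<in> G" for u s
    proof -
      have "bdd_above ((\<lambda>(u, s). s - p (\<lambda>x. u x - v0 x)) ` G)"
        using sep[OF _ G_zero] by (intro bdd_aboveI2[where M = "p (\<lambda>x. 0 + v0 x) - 0"]) auto
      from cSUP_upper[OF us this] show ?thesis unfolding c_def by simp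
    qed
    have dominated: "t + r * c \<le> p (\<lambda>x. v x + r *\<^sub>R v0 x)" if vt: "(v, t) \<in> G" for v t r
    proof -
      consider "r = 0" | "r > 0" | "r < 0" by linarith
      then show ?thesis
      proof cases
        case 1 then show ?thesis using Gp[OF vt] by simp
      next
        case 2
        have "r * (inverse r * t + c) \<le> r * p (\<lambda>x. inverse r *\<^sub>R v x + v0 x)"
          using 2 up[OF Gscale[OF vt]] by (intro mult_left_mono) auto
        also have "\<dots> = p (\<lambda>x. r *\<^sub>R (inverse r *\<^sub>R v x + v0 x))"
          using 2 by (intro p_scale[symmetric] V_add V_scale v0 GV[OF vt]) auto
        finally show ?thesis using 2
          by (simp add: distrib_left scaleR_add_right mult.assoc[symmetric])
      next
        case 3
        define q where "q = - r"
        have q: "q > 0" "r = - q" using 3 by (auto simp: q_def)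
        have "q * (inverse q * t - c) \<le> q * p (\<lambda>x. inverse q *\<^sub>R v x - v0 x)"
          using q lo[OF Gscale[OF vt]] by (intro mult_left_mono) auto
        also have "\<dots> = p (\<lambda>x. q *\<^sub>R (inverse q *\<^sub>R v x - v0 x))"
          using q by (intro p_scale[symmetric] V_diff V_scale GV[OF vt]) auto
        finally show ?thesis using q
          by (simp add: right_diff_distrib scaleR_diff_right mult.assoc[symmetric])
      qed
    qed
    define G' where "G' = {((\<lambda>x. v x + r *\<^sub>R v0 x), t + r * c) | v t r. (v, t) \<in> G}"
    have GG': "G \<subseteq> G'"
    proof
      fix z assume "z \<in> G"
      then show "z \<in> G'" unfolding G'_def
        by (intro CollectI exI[of _ "fst z"] exI[of _ "snd z"] exI[of _ "0::real"]) auto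
    qed
    have "lin G'"
      unfolding lin_def
    proof (intro conjI allI impI)
      fix u s v t assume "(u, s) \<in> G'" "(v, t) \<in> G'"
      then obtain u' s' r v' t' q where *: "(u', s') \<in> G" "(v', t') \<in> G"
          "u = (\<lambda>x. u' x + r *\<^sub>R v0 x)" "s = s' + r * c"
          "v = (\<lambda>x. v' x + q *\<^sub>R v0 x)" "t = t' + q * c"
        unfolding G'_def by blast
      show "((\<lambda>x. u x + v x), s + t) \<in> G'"
        unfolding G'_def
      proof (intro CollectI exI conjI)
        show "((\<lambda>x. u' x + v' x), s' + t') \<in> G" by (intro Gadd *)
        show "((\<lambda>x. u x + v x), s + t) = ((\<lambda>x. (u' x + v' x) + (r + q) *\<^sub>R v0 x), (s' + t') + (r + q) * c)"
          by (auto simp: * algebra_simps)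
      qed
    next
      fix q u s assume "(u, s) \<in> G'"
      then obtain u' s' r where *: "(u', s') \<in> G" "u = (\<lambda>x. u' x + r *\<^sub>R v0 x)" "s = s' + r * c"
        unfolding G'_def by blast
      show "((\<lambda>x. q *\<^sub>R u x), q * s) \<in> G'"
        unfolding G'_def
      proof (intro CollectI exI conjI)
        show "((\<lambda>x. q *\<^sub>R u' x), q * s') \<in> G" by (intro Gscale *)
        show "((\<lambda>x. q *\<^sub>R u x), q * s) = ((\<lambda>x. q *\<^sub>R u' x + (q * r) *\<^sub>R v0 x), q * s' + (q * r) * c)"
          by (auto simp: * algebra_simps)
      qed
    qed
    moreover have "u \<in> V \<and> s \<le> p u" if "(u, s) \<in> G'" for u s
      using that dominated unfolding G'_def by (auto intro!: V_add V_scale v0 intro: GV)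
    ultimately have "G' \<in> \<G>" using GG' G0G unfolding \<G>_def by blast
    then have "G' = G" using max GG' by blast
    moreover have "(v0, c) \<in> G'"
      unfolding G'_def using G_zero
      by (intro CollectI exI[of _ "\<lambda>x. 0"] exI[of _ "0::real"] exI[of _ "1::real"]) auto
    ultimately show ?thesis by blast
  qed
  define F where "F u = (THE s. (u, s) \<in> G)" for u
  have F_eq: "F u = s" if "(u, s) \<in> G" for u s
    unfolding F_def using that G_fun by blast
  have F_in: "(u, F u) \<in> G" if "u \<in> V" for u
    using dom[OF that] F_eq by blast
  show thesis
  proof (rule that[of F])
    show "F (\<lambda>x. u x + v x) = F u + F v" if "u \<in> V" "v \<in> V" for u v
      by (intro F_eq Gadd F_in that)
    show "F (\<lambda>x. r *\<^sub>R u x) = r * F u" if "u \<in> V" for r u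
      by (intro F_eq Gscale F_in that)
    show "F u = f u" if "u \<in> W" for u
      using that G0G unfolding G0_def by (intro F_eq) auto
    show "F u \<le> p u" if "u \<in> V" for u
      by (intro Gp F_in that)
  qed
qed

section \<open>Representation of bounded functionals on L1 of a finite measure\<close>

lemma L1_dual_real:
  fixes \<phi> :: "('a \<Rightarrow> real) \<Rightarrow> real" and d :: real
  assumes fin: "finite_measure m" and d: "0 \<le> d"
    and add: "\<And>u v. integrable m u \<Longrightarrow> integrable m v \<Longrightarrow> \<phi> (\<lambda>x. u x + v x) = \<phi> u + \<phi> v"
    and scale: "\<And>r u. integrable m u \<Longrightarrow> \<phi> (\<lambda>x. r * u x) = r * \<phi> u"
    and bound: "\<And>u. integrable m u \<Longrightarrow> \<bar>\<phi> u\<bar> \<le> d * (\<integral>x. \<bar>u x\<bar> \<partial>m)"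
  obtains k where "k \<in> borel_measurable m" "\<And>x. \<bar>k x\<bar> \<le> d"
    "\<And>u. integrable m u \<Longrightarrow> \<phi> u = (\<integral>x. u x * k x \<partial>m)"
proof -
  interpret finite_measure m by fact
  \<comment> \<open>The shift by \<open>d * measure m A\<close> makes the set function nonnegative,
    so Radon-Nikodym applies without signed measures. The bound \<open>2 * d * measure m A\<close>
    gives both continuity at the empty set and absolute continuity; the shift is undone in
    \<open>k0\<close>.\<close>
  define a where "a A = \<phi> (indicator A) + d * measure m A" for A
  have int_ind: "integrable m (indicator A :: 'a \<Rightarrow> real)" if "A \<in> sets m" for A
    using that by (simp add: less_top[symmetric])
  have phi_ind: "\<bar>\<phi> (indicator A)\<bar> \<le> d * measure m A" if A: "A \<in> sets m" for A
    using bound[OF int_ind[OF A]] sets.sets_into_space[OF A] by (simp add: Int_absorb2)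
  have a_ge: "0 \<le> a A" and a_le: "a A \<le> 2 * d * measure m A" if "A \<in> sets m" for A
    using phi_ind[OF that] unfolding a_def by linarith+
  define N where "N = measure_of (space m) (sets m) (\<lambda>A. ennreal (a A))"
  have phi_Un: "\<phi> (indicator (A \<union> B)) = \<phi> (indicator A) + \<phi> (indicator B)"
    if "A \<in> sets m" "B \<in> sets m" "A \<inter> B = {}" for A B
  proof -
    have "(indicator (A \<union> B) :: 'a \<Rightarrow> real) = (\<lambda>x. indicator A x + indicator B x)"
      using that(3) by (auto simp: indicator_def fun_eq_iff)
    then show ?thesis using add[OF int_ind int_ind] that by simp
  qed
  have pos: "positive (sets m) (\<lambda>A. ennreal (a A))"
    using phi_ind[of "{}"] unfolding positive_def a_def by simp
  have "additive (sets m) (\<lambda>A. ennreal (a A))"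
    unfolding additive_def
    by (auto simp: a_ge ennreal_plus[symmetric] simp del: ennreal_plus)
      (simp add: a_def phi_Un finite_measure_Union algebra_simps)
  moreover have "(\<lambda>i. ennreal (a (A i))) \<longlonglongrightarrow> 0"
    if A: "range A \<subseteq> sets m" "decseq A" "(\<Inter>i. A i) = {}" for A
  proof -
    have "(\<lambda>i. measure m (A i)) \<longlonglongrightarrow> measure m (\<Inter>i. A i)"
      by (intro finite_Lim_measure_decseq A)
    then have "(\<lambda>i. 2 * d * measure m (A i)) \<longlonglongrightarrow> 0"
      using A(3) by (intro tendsto_mult_right_zero) simp
    then have "(\<lambda>i. a (A i)) \<longlonglongrightarrow> 0"
      by (rule tendsto_sandwich[rotated 2, OF tendsto_const]) (use A a_ge a_le in auto)
    from tendsto_ennrealI[OF this] show ?thesis by simp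
  qed
  ultimately have ca: "countably_additive (sets m) (\<lambda>A. ennreal (a A))"
    by (intro sets.empty_continuous_imp_countably_additive pos) auto
  have emN: "emeasure N A = ennreal (a A)" if "A \<in> sets m" for A
    unfolding N_def by (rule emeasure_measure_of_sigma[OF sets.sigma_algebra_axioms pos ca that])
  have setsN: "sets N = sets m" unfolding N_def by simp
  have "absolutely_continuous m N"
    unfolding absolutely_continuous_def
  proof
    fix A assume "A \<in> null_sets m"
    then have "A \<in> sets m" "measure m A = 0" by (auto simp: measure_def)
    then show "A \<in> null_sets N"
      using a_ge[of A] a_le[of A] emN[of A] setsN by (auto simp: null_sets_def)
  qed
  from Radon_Nikodym[OF this setsN] obtain f where f[measurable]: "f \<in> borel_measurable m"
    and fN: "density m f = N" by blast
  define f' where "f' x = enn2real (f x)" for x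
  have f'[measurable]: "f' \<in> borel_measurable m" unfolding f'_def by measurable
  have "(\<integral>\<^sup>+x. f x \<partial>m) = emeasure N (space m)"
    unfolding fN[symmetric] by (subst emeasure_density) (auto intro!: nn_integral_cong)
  then have nnf: "(\<integral>\<^sup>+x. f x \<partial>m) = ennreal (a (space m))"
    using emN by simp
  then have "AE x in m. f x \<noteq> \<infinity>" by (intro nn_integral_PInf_AE) auto
  then have ff': "AE x in m. f x = ennreal (f' x)"
    unfolding f'_def by (auto simp: less_top)
  have "(\<integral>\<^sup>+x. ennreal (f' x) \<partial>m) = (\<integral>\<^sup>+x. f x \<partial>m)"
    using ff' by (intro nn_integral_cong_AE) auto
  then have intf': "integrable m f'"
    using nnf by (intro integrableI_nonneg) (auto simp: f'_def)
  have int_A: "(\<integral>x. indicator A x * f' x \<partial>m) = a A" if A: "A \<in> sets m" for A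
  proof -
    have "(\<integral>\<^sup>+x. ennreal (indicator A x * f' x) \<partial>m) = (\<integral>\<^sup>+x. f x * indicator A x \<partial>m)"
      using ff' by (intro nn_integral_cong_AE) (auto simp: indicator_def)
    also have "\<dots> = ennreal (a A)"
      using A emN fN by (subst emeasure_density[symmetric]) auto
    finally show ?thesis using A a_ge[OF A]
      by (subst integral_eq_nn_integral) (auto simp: f'_def)
  qed
  define k0 where "k0 x = f' x - d" for x
  have intk0: "integrable m k0" unfolding k0_def using intf' by simp
  have k0_A: "(\<integral>x. indicator A x * k0 x \<partial>m) = \<phi> (indicator A)" if A: "A \<in> sets m" for A
  proof -
    have "integrable m (\<lambda>x. indicator A x *\<^sub>R f' x)"
      by (rule integrable_mult_indicator[OF A intf'])
    then have "(\<integral>x. indicator A x * k0 x \<partial>m) = (\<integral>x. indicator A x * f' x \<partial>m) - (\<integral>x. indicator A x * d \<partial>m)"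
      unfolding k0_def using int_ind[OF A] by (simp add: right_diff_distrib)
    also have "(\<integral>x. indicator A x * d \<partial>m) = measure m A * d"
      using A sets.sets_into_space[OF A] by (simp add: Int_absorb2)
    finally show ?thesis using int_A[OF A] by (simp add: a_def)
  qed
  \<comment> \<open>All averages of \<open>k0\<close> over sets of positive measure lie in this
    closed interval, hence so do almost all its values.\<close>
  have "AE x in m. k0 x \<in> {-d..d}"
  proof (rule averaging_theorem[OF intk0])
    fix A assume A: "A \<in> sets m" "0 < measure m A"
    have "\<bar>set_lebesgue_integral m A k0\<bar> \<le> d * measure m A"
      using k0_A[OF A(1)] phi_ind[OF A(1)] by (simp add: set_lebesgue_integral_def)
    then show "(1 / measure m A) *\<^sub>R set_lebesgue_integral m A k0 \<in> {-d..d}"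
      using A(2) by (auto simp: field_simps abs_le_iff)
  qed simp
  \<comment> \<open>Truncation changes \<open>k0\<close> on a null set only and makes the bound hold
    at every point, as the conclusion demands.\<close>
  define k where "k x = max (-d) (min d (k0 x))" for x
  have kk0: "AE x in m. k0 x = k x" using \<open>AE x in m. k0 x \<in> {-d..d}\<close>
    by eventually_elim (auto simp: k_def)
  have k_meas[measurable]: "k \<in> borel_measurable m"
    unfolding k_def k0_def by measurable
  have k_le: "\<bar>k x\<bar> \<le> d" for x using d unfolding k_def by auto
  have int_k: "integrable m (\<lambda>x. u x * k x)" if "integrable m u" for u
    by (rule Bochner_Integration.integrable_bound[of _ "\<lambda>x. d * u x"])
      (use that d k_le in \<open>auto simp: abs_mult mult.commute mult_right_mono\<close>)
  have "\<phi> u = (\<integral>x. u x * k x \<partial>m)" if "integrable m u" for u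
    using that
  proof (induction u rule: integrable_induct)
    case (base A c)
    have "\<phi> (\<lambda>x. indicator A x *\<^sub>R c) = c * \<phi> (indicator A)"
      using scale[OF int_ind[OF base(1)], of c] by (simp add: mult.commute)
    also have "\<phi> (indicator A) = (\<integral>x. indicator A x * k x \<partial>m)"
      unfolding k0_A[OF base(1), symmetric]
      using base kk0 by (intro integral_cong_AE) (auto simp: k0_def)
    finally show ?case by (simp add: mult.commute mult.left_commute)
  next
    case (add f g)
    then show ?case using int_k by (simp add: assms(3) distrib_right)
  next
    case (lim f s)
    have "(\<lambda>i. \<integral>x. s i x * k x \<partial>m) \<longlonglongrightarrow> (\<integral>x. f x * k x \<partial>m)"
    proof (rule integral_dominated_convergence[where w = "\<lambda>x. 2 * \<bar>f x\<bar> * d"])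
      show "AE x in m. (\<lambda>i. s i x * k x) \<longlonglongrightarrow> f x * k x"
        using lim(2) by (intro AE_I2 tendsto_intros)
      show "AE x in m. norm (s i x * k x) \<le> 2 * \<bar>f x\<bar> * d" for i
        using lim(3)[of _ i] k_le by (intro AE_I2) (auto simp: abs_mult intro!: mult_mono)
    qed (use lim in auto)
    moreover have "(\<lambda>i. \<phi> (s i)) \<longlonglongrightarrow> \<phi> f"
    proof -
      \<comment> \<open>The approximating functions satisfy
        \<open>\<bar>s i x\<bar> \<le> 2 * \<bar>f x\<bar>\<close>, hence the majorant with factor
        3.\<close>
      have "(\<lambda>i. \<integral>x. \<bar>s i x - f x\<bar> \<partial>m) \<longlonglongrightarrow> (\<integral>x. 0 \<partial>m)"
      proof (rule integral_dominated_convergence[where w = "\<lambda>x. 3 * \<bar>f x\<bar>"])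
        show "AE x in m. (\<lambda>i. \<bar>s i x - f x\<bar>) \<longlonglongrightarrow> 0"
          using lim(2) by (intro AE_I2 tendsto_rabs_zero) (simp add: LIM_zero_iff)
        show "AE x in m. norm \<bar>s i x - f x\<bar> \<le> 3 * \<bar>f x\<bar>" for i
          using lim(3)[of _ i] by (intro AE_I2) fastforce
      qed (use lim in auto)
      then have lim0: "(\<lambda>i. d * (\<integral>x. \<bar>s i x - f x\<bar> \<partial>m)) \<longlonglongrightarrow> 0"
        by (intro tendsto_mult_right_zero) simp
      have le: "norm (\<phi> (s i) - \<phi> f) \<le> d * (\<integral>x. \<bar>s i x - f x\<bar> \<partial>m)" for i
      proof -
        have "\<phi> (\<lambda>x. s i x + (-1) * f x) = \<phi> (s i) + (-1) * \<phi> f"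
          using lim by (subst assms(3)) (auto simp only: scale integrable_mult_right)
        then show ?thesis
          using bound[of "\<lambda>x. s i x - f x"] lim by simp
      qed
      have "(\<lambda>i. \<phi> (s i) - \<phi> f) \<longlonglongrightarrow> 0"
        using le by (intro Lim_null_comparison[OF _ lim0]) auto
      then show ?thesis by (simp add: LIM_zero_iff)
    qed
    ultimately show ?case using lim(5) LIMSEQ_unique by simp
  qed
  with k_meas k_le show thesis by (rule that)
qed

lemma unimodular_rotation:
  obtains c where "cmod c = 1" "c * w = complex_of_real (cmod w)"
proof -
  define c where "c = (if w = 0 then 1 else cnj w / cmod w)"
  have "cmod c = 1" by (simp add: c_def norm_divide)
  moreover have "cnj w * w = complex_of_real (cmod w) * complex_of_real (cmod w)"
    using complex_norm_square[of w] by (simp only: power2_eq_square of_real_mult mult.commute)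
  then have "c * w = cmod w" by (simp add: c_def)
  ultimately show thesis by (rule that)
qed

text \<open>The functional is only real-linear, so it is represented separately on real and on
  purely imaginary functions by \<open>k1\<close> and \<open>k2\<close>. With
  \<open>k0 = k1 - \<i> * k2\<close>, the real part of \<open>u * k0\<close> is
  \<open>Re u * k1 + Im u * k2\<close>. This gives only the bound \<open>2 * d\<close>; the sharp
  \<open>d\<close> comes from averages of \<open>k0\<close>.\<close>

lemma L1_dual_complex:
  fixes \<phi> :: "('a \<Rightarrow> complex) \<Rightarrow> real" and d :: real
  assumes fin: "finite_measure m" and d: "0 \<le> d"
    and add: "\<And>u v. integrable m u \<Longrightarrow> integrable m v \<Longrightarrow> \<phi> (\<lambda>x. u x + v x) = \<phi> u + \<phi> v"
    and scale: "\<And>r u. integrable m u \<Longrightarrow> \<phi> (\<lambda>x. r *\<^sub>R u x) = r * \<phi> u"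
    and bound: "\<And>u. integrable m u \<Longrightarrow> \<bar>\<phi> u\<bar> \<le> d * (\<integral>x. cmod (u x) \<partial>m)"
  obtains k where "k \<in> borel_measurable m" "\<And>x. cmod (k x) \<le> d"
    "\<And>u. integrable m u \<Longrightarrow> \<phi> u = Re (\<integral>x. u x * k x \<partial>m)"
proof -
  interpret finite_measure m by fact
  have rep: "\<exists>k. k \<in> borel_measurable m \<and> (\<forall>x. \<bar>k x\<bar> \<le> d) \<and>
      (\<forall>u. integrable m u \<longrightarrow> \<phi> (\<lambda>x. c * complex_of_real (u x)) = (\<integral>x. u x * k x \<partial>m))"
    if c: "cmod c = 1" for c
  proof -
    have add': "\<phi> (\<lambda>x. c * complex_of_real (u x + v x)) =
        \<phi> (\<lambda>x. c * complex_of_real (u x)) + \<phi> (\<lambda>x. c * complex_of_real (v x))"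
      if "integrable m u" "integrable m v" for u v
      using add[of "\<lambda>x. c * complex_of_real (u x)" "\<lambda>x. c * complex_of_real (v x)"] that
      by (simp add: distrib_left)
    have scale': "\<phi> (\<lambda>x. c * complex_of_real (r * u x)) = r * \<phi> (\<lambda>x. c * complex_of_real (u x))"
      if "integrable m u" for r u
      using scale[of "\<lambda>x. c * complex_of_real (u x)" r] that
      by (simp add: scaleR_conv_of_real mult.left_commute)
    have bound': "\<bar>\<phi> (\<lambda>x. c * complex_of_real (u x))\<bar> \<le> d * (\<integral>x. \<bar>u x\<bar> \<partial>m)"
      if "integrable m u" for u
      using bound[of "\<lambda>x. c * complex_of_real (u x)"] that by (simp add: norm_mult c)
    show ?thesis
      by (rule L1_dual_real[OF fin d, of "\<lambda>u. \<phi> (\<lambda>x. c * complex_of_real (u x))",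
            OF add' scale' bound']) blast+
  qed
  obtain k1 where k1[measurable]: "k1 \<in> borel_measurable m" and k1_le: "\<And>x. \<bar>k1 x\<bar> \<le> d"
    and k1_eq: "\<And>u. integrable m u \<Longrightarrow> \<phi> (\<lambda>x. complex_of_real (u x)) = (\<integral>x. u x * k1 x \<partial>m)"
    using rep[of 1] by auto
  obtain k2 where k2[measurable]: "k2 \<in> borel_measurable m" and k2_le: "\<And>x. \<bar>k2 x\<bar> \<le> d"
    and k2_eq: "\<And>u. integrable m u \<Longrightarrow> \<phi> (\<lambda>x. \<i> * complex_of_real (u x)) = (\<integral>x. u x * k2 x \<partial>m)"
    using rep[of \<i>] by auto
  define k0 where "k0 x = Complex (k1 x) (- k2 x)" for x
  have k0_le: "cmod (k0 x) \<le> 2 * d" for x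
    using cmod_le[of "k0 x"] k1_le[of x] k2_le[of x] by (simp add: k0_def)
  have k0_alt: "k0 = (\<lambda>x. complex_of_real (k1 x) - \<i> * complex_of_real (k2 x))"
    by (auto simp: k0_def complex_eq_iff)
  have k0[measurable]: "k0 \<in> borel_measurable m" unfolding k0_alt by measurable
  have int_k0: "integrable m (\<lambda>x. u x * k0 x)" if "integrable m u" for u
    by (rule Bochner_Integration.integrable_bound[of _ "\<lambda>x. (2 * d) *\<^sub>R u x"])
      (use that d k0_le in \<open>auto simp: norm_mult mult.commute[of "cmod (u _)"] intro!: mult_right_mono\<close>)
  have int_kr: "integrable m (\<lambda>x. u x * k x)"
    if "integrable m u" "k \<in> borel_measurable m" "\<And>x. \<bar>k x\<bar> \<le> d" for u k :: "'a \<Rightarrow> real"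
    by (rule Bochner_Integration.integrable_bound[of _ "\<lambda>x. d * u x"])
      (use that d in \<open>auto simp: abs_mult mult.commute mult_right_mono\<close>)
  have eq: "\<phi> u = Re (\<integral>x. u x * k0 x \<partial>m)" if u: "integrable m u" for u
  proof -
    have "\<phi> u = \<phi> (\<lambda>x. complex_of_real (Re (u x)) + \<i> * complex_of_real (Im (u x)))"
      by (simp add: complex_eq[symmetric])
    also have "\<dots> = (\<integral>x. Re (u x) * k1 x \<partial>m) + (\<integral>x. Im (u x) * k2 x \<partial>m)"
      using u by (subst add) (auto simp: k1_eq k2_eq intro!: integrable_mult_right)
    also have "\<dots> = (\<integral>x. Re (u x) * k1 x + Im (u x) * k2 x \<partial>m)"
      using u by (intro Bochner_Integration.integral_add[symmetric] int_kr) (auto simp: k1_le k2_le)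
    also have "\<dots> = (\<integral>x. Re (u x * k0 x) \<partial>m)"
      by (simp add: k0_def)
    also have "\<dots> = Re (\<integral>x. u x * k0 x \<partial>m)"
      by (rule integral_Re[OF int_k0[OF u]])
    finally show ?thesis .
  qed
  have intk: "integrable m k0"
    using int_k0[of "\<lambda>x. 1"] by simp
  have "AE x in m. k0 x \<in> cball 0 d"
  proof (rule averaging_theorem[OF intk])
    fix A assume A: "A \<in> sets m" "0 < measure m A"
    define w where "w = set_lebesgue_integral m A k0"
    obtain c where c1: "cmod c = 1" and c: "c * w = cmod w" using unimodular_rotation .
    \<comment> \<open>Rotating the indicator by \<open>c\<close> makes the integral of
      \<open>u * k0\<close> equal to the modulus of \<open>w\<close>, so the bound on
      \<open>\<phi>\<close> controls the complex average.\<close>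
    define u where "u x = indicator A x *\<^sub>R c" for x
    have u: "integrable m u" unfolding u_def using A by (simp add: less_top[symmetric])
    have "c * w = (\<integral>x. c * (indicator A x *\<^sub>R k0 x) \<partial>m)"
      unfolding w_def set_lebesgue_integral_def by (simp del: mult_scaleR_right)
    also have "\<dots> = (\<integral>x. u x * k0 x \<partial>m)"
      unfolding u_def by (simp add: scaleR_conv_of_real mult_ac)
    finally have "cmod w = \<phi> u" using eq[OF u] c by (metis Re_complex_of_real)
    also have "\<dots> \<le> d * (\<integral>x. cmod (u x) \<partial>m)" using bound[OF u] by simp
    also have "(\<integral>x. cmod (u x) \<partial>m) = measure m A"
      unfolding u_def using A sets.sets_into_space[OF A(1)] by (simp add: c1 Int_absorb2)
    finally show "(1 / measure m A) *\<^sub>R set_lebesgue_integral m A k0 \<in> cball 0 d"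
      using A(2) unfolding w_def by (simp add: field_simps)
  qed simp
  then have ae: "AE x in m. cmod (k0 x) \<le> d" by simp
  define k where "k x = (if cmod (k0 x) \<le> d then k0 x else 0)" for x
  show thesis
  proof (rule that[of k])
    show k[measurable]: "k \<in> borel_measurable m" unfolding k_def by measurable
    show "cmod (k x) \<le> d" for x using d by (simp add: k_def)
    show "\<phi> u = Re (\<integral>x. u x * k x \<partial>m)" if u[unfolded integrable_iff_bounded]: "integrable m u" for u
    proof -
      have [measurable]: "u \<in> borel_measurable m" using that by simp
      have "(\<integral>x. u x * k0 x \<partial>m) = (\<integral>x. u x * k x \<partial>m)"
        using ae by (intro integral_cong_AE) (auto simp: k_def)
      then show ?thesis using eq that by simp
    qed
  qed
qed

text \<open>Hahn-Banach is applied to the real part. Agreement of real parts on \<open>Y\<close>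
  suffices because \<open>Y\<close> is closed under multiplication by \<open>\<i>\<close>. The
  constant \<open>d\<close> is preserved, which keeps the distance formula free of extra
  factors.\<close>

lemma L1_functional_extension:
  fixes f :: "'a \<Rightarrow> complex" and Y :: "('a \<Rightarrow> complex) set"
  assumes fin: "finite_measure m" and d: "0 \<le> d"
    and Y_ne: "Y \<noteq> {}" and Y_int: "\<And>g. g \<in> Y \<Longrightarrow> integrable m g"
    and Y_add: "\<And>g h. g \<in> Y \<Longrightarrow> h \<in> Y \<Longrightarrow> (\<lambda>x. g x + h x) \<in> Y"
    and Y_scale: "\<And>c g. g \<in> Y \<Longrightarrow> (\<lambda>x. c * g x) \<in> Y"
    and f_int: "\<And>g. g \<in> Y \<Longrightarrow> integrable m (\<lambda>x. g x * f x)"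
    and f_le: "\<And>g. g \<in> Y \<Longrightarrow> cmod (\<integral>x. g x * f x \<partial>m) \<le> d * (\<integral>x. cmod (g x) \<partial>m)"
  obtains k where "k \<in> borel_measurable m" "\<And>x. cmod (k x) \<le> d"
    "\<And>g. g \<in> Y \<Longrightarrow> (\<integral>x. g x * k x \<partial>m) = (\<integral>x. g x * f x \<partial>m)"
proof -
  define p where "p u = d * (\<integral>x. cmod (u x) \<partial>m)" for u :: "'a \<Rightarrow> complex"
  define V where "V = {u :: 'a \<Rightarrow> complex. integrable m u}"
  obtain F where F_add: "\<And>u v. u \<in> V \<Longrightarrow> v \<in> V \<Longrightarrow> F (\<lambda>x. u x + v x) = F u + F v"
    and F_scale: "\<And>r u. u \<in> V \<Longrightarrow> F (\<lambda>x. r *\<^sub>R u x) = r * F u"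
    and F_Y: "\<And>u. u \<in> Y \<Longrightarrow> F u = Re (\<integral>x. u x * f x \<partial>m)"
    and F_le: "\<And>u. u \<in> V \<Longrightarrow> F u \<le> p u"
  proof (rule hahn_banach_fun[of V Y p "\<lambda>u. Re (\<integral>x. u x * f x \<partial>m)"])
    show "p (\<lambda>x. u x + v x) \<le> p u + p v" if "u \<in> V" "v \<in> V" for u v
    proof -
      have "(\<integral>x. cmod (u x + v x) \<partial>m) \<le> (\<integral>x. cmod (u x) + cmod (v x) \<partial>m)"
        using that by (intro integral_mono) (auto simp: V_def norm_triangle_ineq)
      also have "\<dots> = (\<integral>x. cmod (u x) \<partial>m) + (\<integral>x. cmod (v x) \<partial>m)"
        using that by (simp add: V_def)
      finally show ?thesis unfolding p_def distrib_left[symmetric]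
        using d by (intro mult_left_mono) auto
    qed
    show "Re (\<integral>x. (r *\<^sub>R u x) * f x \<partial>m) = r * Re (\<integral>x. u x * f x \<partial>m)" if "u \<in> Y" for r u
      by simp
    show "(\<lambda>x. r *\<^sub>R u x) \<in> Y" if "u \<in> Y" for r u
      using Y_scale[OF that, of "complex_of_real r"] by (simp add: scaleR_conv_of_real)
    show "Re (\<integral>x. u x * f x \<partial>m) \<le> p u" if "u \<in> Y" for u
      using f_le[OF that] complex_Re_le_cmod order_trans unfolding p_def by blast
  qed (use Y_ne Y_int Y_add f_int in \<open>auto simp: V_def p_def distrib_right\<close>)
  have F_abs: "\<bar>F u\<bar> \<le> p u" if "u \<in> V" for u
  proof -
    have "- F u = F (\<lambda>x. (-1) *\<^sub>R u x)" by (subst F_scale[OF that]) simp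
    also have "\<dots> \<le> p (\<lambda>x. (-1) *\<^sub>R u x)" using that by (intro F_le) (auto simp: V_def)
    also have "\<dots> = p u" by (simp add: p_def)
    finally show ?thesis using F_le[OF that] by simp
  qed
  obtain k where k[measurable]: "k \<in> borel_measurable m" and k_le: "\<And>x. cmod (k x) \<le> d"
    and F_eq: "\<And>u. integrable m u \<Longrightarrow> F u = Re (\<integral>x. u x * k x \<partial>m)"
    by (rule L1_dual_complex[OF fin d, of F])
      (use F_add F_scale F_abs in \<open>auto simp: V_def p_def\<close>)
  have Re_eq: "Re (\<integral>x. g x * k x \<partial>m) = Re (\<integral>x. g x * f x \<partial>m)" if "g \<in> Y" for g
    using F_eq[OF Y_int[OF that]] F_Y[OF that] by simp
  have "(\<integral>x. g x * k x \<partial>m) = (\<integral>x. g x * f x \<partial>m)" if "g \<in> Y" for g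
  proof (rule complex_eqI)
    show "Re (\<integral>x. g x * k x \<partial>m) = Re (\<integral>x. g x * f x \<partial>m)" by (rule Re_eq[OF that])
    have "Re (\<i> * (\<integral>x. g x * k x \<partial>m)) = Re (\<i> * (\<integral>x. g x * f x \<partial>m))"
      using Re_eq[OF Y_scale[OF that, of \<i>]] by (simp add: mult.assoc)
    then show "Im (\<integral>x. g x * k x \<partial>m) = Im (\<integral>x. g x * f x \<partial>m)" by simp
  qed
  with k k_le show thesis by (rule that)
qed

section \<open>Haar measure and the Rosenthal property\<close>

locale compact_haar_group =
  fixes m :: "'a::{topological_ab_group_add, t2_space} measure"
  assumes compact_group: "compact (UNIV :: 'a set)"
    and infinite_group: "infinite (UNIV :: 'a set)"
    and haar: "normalized_haar_measure m"
begin

lemma sets_haar [measurable_cong, simp]: "sets m = sets borel"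
  using haar unfolding normalized_haar_measure_def by blast

lemma space_haar [simp]: "space m = UNIV"
  using sets_eq_imp_space_eq[OF sets_haar] by simp

lemma emeasure_haar_UNIV [simp]: "emeasure m UNIV = 1"
  using haar unfolding normalized_haar_measure_def by blast

sublocale finite_measure m
  by standard simp

lemma measure_haar_UNIV [simp]: "measure m UNIV = 1"
  by (simp add: measure_def)

lemma measurable_continuous:
  "continuous_on UNIV f \<Longrightarrow> f \<in> borel_measurable m"
  using borel_measurable_continuous_onI by (simp cong: measurable_cong_sets)

lemma continuous_bounded:
  fixes f :: "'a \<Rightarrow> complex"
  assumes "continuous_on UNIV f"
  obtains B where "0 \<le> B" "\<And>x. cmod (f x) \<le> B"
proof -
  have "bounded (range f)"
    using compact_continuous_image[OF assms compact_group] compact_imp_bounded by blast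
  then show thesis using that unfolding bounded_pos by (metis rangeI less_imp_le)
qed

lemma continuous_bcontfun:
  fixes f :: "'a \<Rightarrow> complex"
  assumes "continuous_on UNIV f"
  shows "f \<in> bcontfun"
  using assms by (rule continuous_bounded) (blast intro: bcontfun_normI assms)

lemma integrable_bounded:
  fixes f :: "'a \<Rightarrow> complex"
  assumes "f \<in> borel_measurable m" "\<And>x. cmod (f x) \<le> B"
  shows "integrable m f"
  using assms by (intro integrable_const_bound[of _ B]) auto

lemma integrable_continuous:
  fixes f :: "'a \<Rightarrow> complex"
  assumes "continuous_on UNIV f"
  shows "integrable m f"
  using assms by (rule continuous_bounded)
    (blast intro: integrable_bounded measurable_continuous assms)

section \<open>Full support of Haar measure and absence of isolated points\<close>

lemma emeasure_translate:
  assumes "open V"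
  shows "emeasure m ((\<lambda>x. a + x) -` V) = emeasure m V"
proof -
  have "continuous_on UNIV (\<lambda>x. a + x)" by (intro continuous_intros)
  then have "(\<lambda>x. a + x) \<in> borel_measurable m" by (rule measurable_continuous)
  then have "emeasure (distr m borel (\<lambda>x. a + x)) V = emeasure m ((\<lambda>x. a + x) -` V)"
    using assms by (subst emeasure_distr) auto
  then show ?thesis using haar unfolding normalized_haar_measure_def by simp
qed

lemma open_translate: "open V \<Longrightarrow> open ((\<lambda>x. a + x) -` (V :: 'a set))"
  by (rule open_vimage) (auto intro!: continuous_intros)

text \<open>Finitely many translates of \<open>V\<close> cover the compact group, and all have the
  measure of \<open>V\<close>; they cannot all be null.\<close>

lemma emeasure_open_pos:
  assumes "open V" "V \<noteq> {}"
  shows "emeasure m V > 0"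
proof (rule ccontr)
  assume "\<not> emeasure m V > 0"
  then have 0: "emeasure m V = 0" by simp
  obtain v where v: "v \<in> V" using assms(2) by blast
  have cover: "UNIV \<subseteq> (\<Union>a\<in>UNIV. (\<lambda>x. a + x) -` V)"
  proof
    fix x have "v - x + x \<in> V" using v by simp
    then show "x \<in> (\<Union>a\<in>UNIV. (\<lambda>x. a + x) -` V)" by blast
  qed
  obtain C where "finite C" "UNIV \<subseteq> (\<Union>a\<in>C. (\<lambda>x. a + x) -` V)"
    by (rule compactE_image[OF compact_group _ cover]) (auto intro: open_translate[OF assms(1)])
  then have "emeasure m UNIV \<le> emeasure m (\<Union>a\<in>C. (\<lambda>x. a + x) -` V)"
    using open_translate[OF assms(1)] by (intro emeasure_mono) auto
  also have "\<dots> \<le> (\<Sum>a\<in>C. emeasure m ((\<lambda>x. a + x) -` V))"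
    using \<open>finite C\<close> open_translate[OF assms(1)] by (intro emeasure_subadditive_finite) auto
  also have "\<dots> = 0" using 0 by (simp add: emeasure_translate[OF assms(1)])
  finally show False by simp
qed

lemma AE_open:
  assumes "AE x in m. P x" "open W" "W \<noteq> {}"
  shows "\<exists>x\<in>W. P x"
proof (rule ccontr)
  assume neg: "\<not> (\<exists>x\<in>W. P x)"
  obtain N where N: "{x \<in> space m. \<not> P x} \<subseteq> N" "emeasure m N = 0" "N \<in> sets m"
    using AE_E[OF assms(1)] by blast
  then have "W \<subseteq> N" using neg by auto
  then have "emeasure m W \<le> emeasure m N" using N(3) by (rule emeasure_mono)
  then show False using N(2) emeasure_open_pos[OF assms(2,3)] by simp
qed

text \<open>By full support, essential bounds on continuous functions are pointwise bounds; this
  links the duality estimates to the supremum norm.\<close>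

lemma AE_continuous_le:
  fixes f :: "'a \<Rightarrow> real"
  assumes "continuous_on UNIV f" "AE x in m. f x \<le> d"
  shows "f x \<le> d"
proof (rule ccontr)
  assume "\<not> f x \<le> d"
  then have "{x. d < f x} \<noteq> {}" by (auto simp: not_le)
  moreover have "open {x. d < f x}"
    by (intro open_Collect_less assms(1)) auto
  ultimately show False using AE_open[OF assms(2)] by fastforce
qed

text \<open>By translation, one open point would make the group discrete, and a compact discrete
  space is finite.\<close>

lemma not_open_singleton: "\<not> open {a :: 'a}"
proof
  assume op: "open {a}"
  have sing: "open {x}" for x :: 'a
  proof -
    have "(\<lambda>y. (a - x) + y) -` {a} = {x}" by (auto simp: algebra_simps)
    then show ?thesis using open_translate[OF op, of "a - x"] by simp
  qed
  obtain C :: "'a set" where "finite C" "UNIV \<subseteq> (\<Union>x\<in>C. {x})"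
    by (rule compactE_image[OF compact_group, of UNIV "\<lambda>x. {x}"]) (auto intro: sing)
  then show False using infinite_group by (simp add: finite_subset)
qed

lemma open_split:
  assumes "open (V :: 'a set)" "V \<noteq> {}"
  obtains O1 O2 where "open O1" "open O2" "O1 \<noteq> {}" "O2 \<noteq> {}" "O1 \<subseteq> V" "O2 \<subseteq> V" "O1 \<inter> O2 = {}"
proof -
  obtain a where a: "a \<in> V" using assms by blast
  have "V \<noteq> {a}" using assms(1) not_open_singleton[of a] by auto
  then obtain b where b: "b \<in> V" "b \<noteq> a" using a by blast
  obtain U W where "open U" "open W" "a \<in> U" "b \<in> W" "U \<inter> W = {}"
    using hausdorff[of a b] b(2) by blast
  then show thesis using a b assms(1) by (intro that[of "U \<inter> V" "W \<inter> V"]) auto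
qed

text \<open>The continuous members of \<open>L\<^sup>1\<close> over \<open>\<Gamma> - \<Lambda>\<inverse>\<close>, described by duality so that no density of
  trigonometric polynomials is needed.\<close>

definition annihilator :: "('a \<Rightarrow> complex) set \<Rightarrow> ('a \<Rightarrow> complex) set" where
  "annihilator \<Lambda> = {g. continuous_on UNIV g \<and> (\<forall>h\<in>Linfty_spec m \<Lambda>. (\<integral>x. g x * h x \<partial>m) = 0)}"

lemma Linfty_integrable_mult:
  assumes g: "continuous_on UNIV g" and h: "h \<in> Linfty m"
  shows "integrable m (\<lambda>x. g x * h x)"
proof -
  obtain B where B: "0 \<le> B" "\<And>x. cmod (g x) \<le> B"
    using continuous_bounded[OF g] by blast
  obtain K where K: "AE x in m. cmod (h x) \<le> K" and [measurable]: "h \<in> borel_measurable m"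
    using h unfolding Linfty_def by blast
  have [measurable]: "g \<in> borel_measurable m" using measurable_continuous[OF g] .
  have "AE x in m. cmod (g x * h x) \<le> B * K"
    using K by eventually_elim (use B in \<open>auto simp: norm_mult intro!: mult_mono\<close>)
  then show ?thesis by (rule integrable_const_bound) simp
qed

lemma annihilator_add:
  assumes "g \<in> annihilator \<Lambda>" "h \<in> annihilator \<Lambda>"
  shows "(\<lambda>x. g x + h x) \<in> annihilator \<Lambda>"
  using assms unfolding annihilator_def Linfty_spec_def
  by (auto simp: distrib_right Linfty_integrable_mult intro!: continuous_intros)

lemma annihilator_scale:
  assumes "g \<in> annihilator \<Lambda>"
  shows "(\<lambda>x. c * g x) \<in> annihilator \<Lambda>"
  using assms unfolding annihilator_def
  by (auto simp: mult.assoc intro!: continuous_intros)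

text \<open>Integration against the conjugate of \<open>\<gamma>\<close> is the Fourier coefficient
  at \<open>\<gamma>\<close>. Hence two functions with equal integrals against the annihilator
  differ by one whose coefficients vanish off \<open>\<Lambda>\<close>.\<close>

lemma cnj_character_annihilator:
  assumes "\<gamma> \<in> dual_group - \<Lambda>"
  shows "(\<lambda>x. cnj (\<gamma> x)) \<in> annihilator \<Lambda>"
  using assms unfolding annihilator_def Linfty_spec_def fourier_coeff_def dual_group_def
  by (auto simp: mult.commute intro!: continuous_intros)

text \<open>The functional \<open>g \<mapsto> \<integral>gf\<close> on the annihilator extends to \<open>L\<^sup>1\<close> with norm \<open>d\<close>, hence is given by some \<open>k\<close>
  with \<open>\<bar>k\<bar> \<le> d\<close>; then \<open>f - k\<close> has spectrum in \<open>\<Lambda>\<close>, so it is almost everywhere continuous.\<close>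

lemma rosenthal_approximation:
  fixes f :: "'a \<Rightarrow> complex"
  assumes ros: "rosenthal_set m \<Lambda>"
    and f[measurable]: "f \<in> borel_measurable m" and fB: "\<And>x. cmod (f x) \<le> B"
    and d: "0 \<le> d"
    and le: "\<And>g. g \<in> annihilator \<Lambda> \<Longrightarrow>
      cmod (\<integral>x. g x * f x \<partial>m) \<le> d * (\<integral>x. cmod (g x) \<partial>m)"
  obtains h where "h \<in> C_spec m \<Lambda>" "AE x in m. cmod (f x - apply_bcontfun h x) \<le> d"
proof -
  have f_Linfty: "f \<in> Linfty m" using fB unfolding Linfty_def by auto
  obtain k where k[measurable]: "k \<in> borel_measurable m" and k_le: "\<And>x. cmod (k x) \<le> d"
    and k_eq: "\<And>g. g \<in> annihilator \<Lambda> \<Longrightarrow> (\<integral>x. g x * k x \<partial>m) = (\<integral>x. g x * f x \<partial>m)"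
  proof (rule L1_functional_extension[OF finite_measure_axioms d, of "annihilator \<Lambda>" f])
    have "(\<lambda>x. 0) \<in> annihilator \<Lambda>" by (simp add: annihilator_def)
    then show "annihilator \<Lambda> \<noteq> {}" by blast
    show "integrable m g" if "g \<in> annihilator \<Lambda>" for g
      using that by (simp add: annihilator_def integrable_continuous)
    show "integrable m (\<lambda>x. g x * f x)" if "g \<in> annihilator \<Lambda>" for g
      using that by (simp add: annihilator_def Linfty_integrable_mult f_Linfty)
  qed (use le annihilator_add annihilator_scale in auto)
  have k_Linfty: "k \<in> Linfty m" using k_le unfolding Linfty_def by auto
  have "AE x in m. cmod (f x - k x) \<le> B + d"
    by (intro AE_I2 order_trans[OF norm_triangle_ineq4] add_mono fB k_le)
  moreover have "fourier_coeff m (\<lambda>x. f x - k x) \<gamma> = 0" if "\<gamma> \<in> dual_group - \<Lambda>" for \<gamma>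
  proof -
    have "continuous_on UNIV (\<lambda>x. cnj (\<gamma> x))"
      using cnj_character_annihilator[OF that] by (simp add: annihilator_def)
    then have "(\<integral>x. cnj (\<gamma> x) * f x - cnj (\<gamma> x) * k x \<partial>m) =
        (\<integral>x. cnj (\<gamma> x) * f x \<partial>m) - (\<integral>x. cnj (\<gamma> x) * k x \<partial>m)"
      using f_Linfty k_Linfty by (intro Bochner_Integration.integral_diff Linfty_integrable_mult)
    also have "\<dots> = 0" using k_eq[OF cnj_character_annihilator[OF that]] by simp
    finally show ?thesis unfolding fourier_coeff_def by (simp add: algebra_simps)
  qed
  ultimately have spec: "(\<lambda>x. f x - k x) \<in> Linfty_spec m \<Lambda>"
    unfolding Linfty_spec_def Linfty_def by auto
  have "\<exists>g. continuous_on UNIV g \<and> (AE x in m. f x - k x = g x)"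
    using ros[unfolded rosenthal_set_def, THEN bspec, OF spec] .
  then obtain g where g: "continuous_on UNIV g" "AE x in m. f x - k x = g x"
    by (elim exE conjE)
  have fc: "fourier_coeff m (\<lambda>x. f x - k x) \<gamma> = 0" if "\<gamma> \<in> dual_group - \<Lambda>" for \<gamma>
    using spec that unfolding Linfty_spec_def by simp
  have [measurable]: "g \<in> borel_measurable m" by (rule measurable_continuous[OF g(1)])
  have gB: "apply_bcontfun (Bcontfun g) = g"
    by (rule Bcontfun_inverse[OF continuous_bcontfun[OF g(1)]])
  have "Bcontfun g \<in> C_spec m \<Lambda>"
    unfolding C_spec_def
  proof (intro CollectI ballI)
    fix \<gamma> :: "'a \<Rightarrow> complex" assume \<gamma>: "\<gamma> \<in> dual_group - \<Lambda>"
    then have [measurable]: "(\<lambda>x. cnj (\<gamma> x)) \<in> borel_measurable m"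
      using cnj_character_annihilator unfolding annihilator_def by (blast intro: measurable_continuous)
    have "fourier_coeff m g \<gamma> = fourier_coeff m (\<lambda>x. f x - k x) \<gamma>"
      unfolding fourier_coeff_def using g(2) by (intro integral_cong_AE borel_measurable_times) auto
    then show "fourier_coeff m (apply_bcontfun (Bcontfun g)) \<gamma> = 0"
      using fc[OF \<gamma>] by (simp add: gB)
  qed
  moreover have "AE x in m. cmod (f x - apply_bcontfun (Bcontfun g) x) \<le> d"
    using g(2) unfolding gB
  proof eventually_elim
    case (elim x)
    then have "f x - g x = k x" by (simp add: algebra_simps)
    then show ?case using k_le by simp
  qed
  ultimately show thesis by (rule that)
qed
end

section \<open>Sets of small variation\<close>

context compact_haar_group
begin

lemma zero_neighbourhood:
  assumes "open W" "(0::'a) \<in> W"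
  shows "\<exists>N. open N \<and> 0 \<in> N \<and> N \<subseteq> W \<and> (\<forall>a\<in>N. - a \<in> N) \<and> (\<forall>a\<in>N. \<forall>b\<in>N. a + b \<in> W)"
proof -
  have "open ((\<lambda>p::'a \<times> 'a. fst p + snd p) -` W)"
    by (rule open_vimage[OF assms(1)]) (intro continuous_intros)
  then obtain A B where AB: "open A" "open B" "(0, 0) \<in> A \<times> B"
      "A \<times> B \<subseteq> (\<lambda>p::'a \<times> 'a. fst p + snd p) -` W"
    by (rule open_prod_elim[where x = "(0, 0)"]) (use assms in auto)
  have neg: "open (uminus -` S)" if "open S" for S :: "'a set"
    by (rule open_vimage[OF that]) (intro continuous_intros)
  define N where "N = (A \<inter> B \<inter> W) \<inter> uminus -` (A \<inter> B \<inter> W)"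
  have "open N" unfolding N_def by (intro open_Int neg AB assms(1))
  moreover have "a + b \<in> W" if "a \<in> N" "b \<in> N" for a b
  proof -
    have "(a, b) \<in> A \<times> B" using that by (auto simp: N_def)
    then show ?thesis using AB(4) by auto
  qed
  moreover have "0 \<in> N" "N \<subseteq> W" "\<forall>a\<in>N. - a \<in> N"
    using AB assms by (auto simp: N_def)
  ultimately show ?thesis by blast
qed

text \<open>Urysohn's lemma reaches the value 1 only at the point \<open>y\<close>; later arguments
  need a whole neighbourhood on which it is attained, given as a translate of a neighbourhood of
  0.\<close>

lemma bump_function:
  assumes "open V" "(y::'a) \<in> V"
  shows "\<exists>(\<rho> :: 'a \<Rightarrow> real) N. continuous_on UNIV \<rho> \<and> (\<forall>x. 0 \<le> \<rho> x \<and> \<rho> x \<le> 1) \<and>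
    (\<forall>x. x \<notin> V \<longrightarrow> \<rho> x = 0) \<and> open N \<and> 0 \<in> N \<and> (\<forall>z\<in>N. \<rho> (y + z) = 1)"
proof -
  have "Hausdorff_space (euclidean :: 'a topology)"
    unfolding Hausdorff_space_def disjnt_def by (auto dest!: hausdorff)
  then   have "normal_space (euclidean :: 'a topology)"
    using compact_group
    by (intro compact_Hausdorff_or_regular_imp_normal_space) (auto simp: compact_space_def)
  then obtain f where f: "continuous_map euclidean (top_of_set {0..1::real}) f" "f ` (- V) \<subseteq> {0}" "f ` {y} \<subseteq> {1}"
    by (rule Urysohn_lemma[of _ "- V" "{y}" 0 1]) (use assms in \<open>auto simp: disjnt_def closed_closedin[symmetric]\<close>)
  have cont: "continuous_on UNIV f" and f01: "\<And>x. f x \<in> {0..1}"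
    using f(1) by (auto simp: continuous_map_in_subtopology)
  \<comment> \<open>Doubling and truncating creates a plateau on the open set where \<open>f\<close>
    exceeds 1/2.\<close>
  define \<rho> where "\<rho> x = min 1 (2 * f x)" for x
  define N where "N = (\<lambda>z. y + z) -` {x. 1/2 < f x}"
  have "continuous_on UNIV \<rho>" unfolding \<rho>_def by (intro continuous_intros cont)
  moreover have "open N" unfolding N_def
    by (intro open_translate open_Collect_less cont continuous_on_const)
  moreover have "0 \<in> N" unfolding N_def using f(3) by simp
  moreover have "0 \<le> \<rho> x \<and> \<rho> x \<le> 1" for x using f01[of x] by (auto simp: \<rho>_def)
  moreover have "\<rho> x = 0" if "x \<notin> V" for x using f(2) that by (auto simp: \<rho>_def)
  moreover have "\<rho> (y + z) = 1" if "z \<in> N" for z using that by (auto simp: \<rho>_def N_def)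
  ultimately show ?thesis by blast
qed

end

text \<open>\<open>\<Phi>\<close> acts on plain functions and is constrained on continuous ones
  only, so products with cutoffs can be fed to it directly.\<close>

locale continuous_functional = compact_haar_group m
  for m :: "'a::{topological_ab_group_add, t2_space} measure" +
  fixes \<Phi> :: "('a \<Rightarrow> complex) \<Rightarrow> complex" and K :: real
  assumes functional_add: "\<And>f g. continuous_on UNIV f \<Longrightarrow> continuous_on UNIV g \<Longrightarrow>
      \<Phi> (\<lambda>x. f x + g x) = \<Phi> f + \<Phi> g"
    and functional_scale: "\<And>c f. continuous_on UNIV f \<Longrightarrow> \<Phi> (\<lambda>x. c * f x) = c * \<Phi> f"
    and functional_bound: "\<And>f B. continuous_on UNIV f \<Longrightarrow> (\<And>x. cmod (f x) \<le> B) \<Longrightarrow>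
      cmod (\<Phi> f) \<le> K * B"
begin

text \<open>For open \<open>V\<close> this bounds the total variation on \<open>V\<close> of the
  measure representing \<open>\<Phi>\<close>. Testing with functions that vanish off
  \<open>V\<close> avoids the Riesz representation theorem.\<close>

definition variation_le :: "'a set \<Rightarrow> real \<Rightarrow> bool" where
  "variation_le V e \<longleftrightarrow> (\<forall>f B. continuous_on UNIV f \<longrightarrow> (\<forall>x. cmod (f x) \<le> B) \<longrightarrow>
     (\<forall>x. x \<notin> V \<longrightarrow> f x = 0) \<longrightarrow> cmod (\<Phi> f) \<le> e * B)"

text \<open>The witness is scaled to the unit ball and rotated until its value is a nonnegative
  real, so that values of two witnesses add without cancellation.\<close>

lemma not_variation_le:
  assumes "\<not> variation_le V e"
  obtains f where "continuous_on UNIV f" "\<And>x. cmod (f x) \<le> 1" "\<And>x. x \<notin> V \<Longrightarrow> f x = 0"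
    "\<Phi> f = complex_of_real (cmod (\<Phi> f))" "e < cmod (\<Phi> f)"
proof -
  obtain f B where f: "continuous_on UNIV f" "\<And>x. cmod (f x) \<le> B" "\<And>x. x \<notin> V \<Longrightarrow> f x = 0"
      "e * B < cmod (\<Phi> f)"
    using assms unfolding variation_le_def by (auto simp: not_le)
  have "0 \<le> B" using norm_ge_zero f(2) order_trans by blast
  moreover have "B \<noteq> 0" using functional_bound[OF f(1,2)] f(4) by auto
  ultimately have B: "B > 0" by simp
  define w where "w = \<Phi> f"
  obtain c where c1: "cmod c = 1" and c: "c * w = cmod w" using unimodular_rotation .
  have eq: "\<Phi> (\<lambda>x. (c / B) * f x) = complex_of_real (cmod w / B)"
    using functional_scale[OF f(1), of "c / B"] c by (simp add: w_def)
  show thesis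
  proof (rule that[of "\<lambda>x. (c / B) * f x"])
    show "continuous_on UNIV (\<lambda>x. (c / B) * f x)" by (intro continuous_intros f(1))
    show "cmod ((c / B) * f x) \<le> 1" for x
      using f(2)[of x] B by (simp add: norm_mult norm_divide c1)
    show "(c / B) * f x = 0" if "x \<notin> V" for x using f(3)[OF that] by simp
    have cm: "cmod (\<Phi> (\<lambda>x. (c / B) * f x)) = cmod w / B"
      unfolding eq using B by (simp add: norm_divide)
    show "\<Phi> (\<lambda>x. (c / B) * f x) = complex_of_real (cmod (\<Phi> (\<lambda>x. (c / B) * f x)))"
      by (subst cm) (rule eq)
    show "e < cmod (\<Phi> (\<lambda>x. (c / B) * f x))"
      unfolding cm using f(4) B by (simp add: w_def field_simps)
  qed
qed

text \<open>Variation is superadditive on disjoint sets: witnesses against \<open>e / 2\<close> on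
  both pieces have a sum still bounded by 1, as their supports do not meet, and its value would
  exceed \<open>e\<close>.\<close>

lemma variation_halve:
  assumes "open V" "V \<noteq> {}" "variation_le V e"
  obtains W where "open W" "W \<noteq> {}" "W \<subseteq> V" "variation_le W (e / 2)"
proof -
  obtain O1 O2 where O: "open O1" "open O2" "O1 \<noteq> {}" "O2 \<noteq> {}" "O1 \<subseteq> V" "O2 \<subseteq> V" "O1 \<inter> O2 = {}"
    using open_split[OF assms(1,2)] .
  have "variation_le O1 (e / 2) \<or> variation_le O2 (e / 2)"
  proof (rule ccontr)
    assume neg: "\<not> (variation_le O1 (e / 2) \<or> variation_le O2 (e / 2))"
    obtain f where f: "continuous_on UNIV f" "\<And>x. cmod (f x) \<le> 1" "\<And>x. x \<notin> O1 \<Longrightarrow> f x = 0"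
      "\<Phi> f = complex_of_real (cmod (\<Phi> f))" "e / 2 < cmod (\<Phi> f)"
      using not_variation_le[of O1 "e / 2"] neg by blast
    obtain g where g: "continuous_on UNIV g" "\<And>x. cmod (g x) \<le> 1" "\<And>x. x \<notin> O2 \<Longrightarrow> g x = 0"
      "\<Phi> g = complex_of_real (cmod (\<Phi> g))" "e / 2 < cmod (\<Phi> g)"
      using not_variation_le[of O2 "e / 2"] neg by blast
    have "cmod (f x + g x) \<le> 1" for x
    proof (cases "x \<in> O1")
      case True
      then have "x \<notin> O2" using O(7) by blast
      then show ?thesis using f(2) g(3) by simp
    qed (use f(3) g(2) in simp)
    moreover have "f x + g x = 0" if "x \<notin> V" for x
    proof -
      have "x \<notin> O1" "x \<notin> O2" using that O(5,6) by blast+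
      then show ?thesis using f(3) g(3) by simp
    qed
    moreover have "continuous_on UNIV (\<lambda>x. f x + g x)" by (intro continuous_intros f(1) g(1))
    ultimately have le: "cmod (\<Phi> (\<lambda>x. f x + g x)) \<le> e * 1"
      using assms(3) unfolding variation_le_def by blast
    have eq: "\<Phi> (\<lambda>x. f x + g x) = complex_of_real (cmod (\<Phi> f) + cmod (\<Phi> g))"
      unfolding functional_add[OF f(1) g(1)] of_real_add f(4)[symmetric] g(4)[symmetric] ..
    have "cmod (\<Phi> (\<lambda>x. f x + g x)) = cmod (\<Phi> f) + cmod (\<Phi> g)"
      unfolding eq norm_of_real by simp
    then show False using le f(5) g(5) by simp
  qed
  then show thesis using that O by blast
qed

text \<open>The norm bound \<open>K\<close> starts the iteration, and repeated halving drives it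
  below \<open>e\<close>.\<close>

lemma variation_small:
  assumes V: "open V" "V \<noteq> {}" and "e > 0"
  obtains W where "open W" "W \<noteq> {}" "W \<subseteq> V" "variation_le W e"
proof -
  have "\<exists>W. open W \<and> W \<noteq> {} \<and> W \<subseteq> V \<and> variation_le W (K / 2 ^ n)" for n
  proof (induction n)
    case 0
    then show ?case using V functional_bound unfolding variation_le_def by auto
  next
    case (Suc n)
    then obtain W where W: "open W" "W \<noteq> {}" "W \<subseteq> V" "variation_le W (K / 2 ^ n)" by blast
    obtain W' where "open W'" "W' \<noteq> {}" "W' \<subseteq> W" "variation_le W' (K / 2 ^ n / 2)"
      using variation_halve[OF W(1,2,4)] .
    then show ?case using W(3) by (intro exI[of _ W']) (auto simp: field_simps)
  qed
  moreover obtain n where "K / 2 ^ n < e"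
  proof -
    have "(\<lambda>n. K * (1 / 2) ^ n) \<longlonglongrightarrow> 0"
      by (intro tendsto_mult_right_zero LIMSEQ_realpow_zero) auto
    then have "eventually (\<lambda>n. K * (1 / 2) ^ n < e) sequentially"
      using \<open>e > 0\<close> by (rule order_tendstoD)
    then show thesis using that by (auto simp: power_divide dest!: eventually_happens)
  qed
  ultimately obtain W where W: "open W" "W \<noteq> {}" "W \<subseteq> V" "variation_le W (K / 2 ^ n)" by blast
  have "variation_le W e"
    unfolding variation_le_def
  proof (intro allI impI)
    fix f :: "'a \<Rightarrow> complex" and B
    assume f: "continuous_on UNIV f" "\<forall>x. cmod (f x) \<le> B" "\<forall>x. x \<notin> W \<longrightarrow> f x = 0"
    have "0 \<le> B" using f(2) norm_ge_zero order_trans by blast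
    have "cmod (\<Phi> f) \<le> K / 2 ^ n * B" using W(4) f unfolding variation_le_def by blast
    also have "\<dots> \<le> e * B" using \<open>K / 2 ^ n < e\<close> \<open>0 \<le> B\<close> by (intro mult_right_mono) auto
    finally show "cmod (\<Phi> f) \<le> e * B" .
  qed
  then show thesis using W that by blast
qed

section \<open>Cutoff functions nearly invisible to the functional\<close>

definition cutoff :: "real \<Rightarrow> ('a \<Rightarrow> real) \<Rightarrow> bool" where
  "cutoff e \<rho> \<longleftrightarrow> continuous_on UNIV \<rho> \<and> (\<forall>x. 0 \<le> \<rho> x \<and> \<rho> x \<le> 1) \<and>
     (\<forall>f B. continuous_on UNIV f \<longrightarrow> (\<forall>x. cmod (f x) \<le> B) \<longrightarrow>
        cmod (\<Phi> (\<lambda>x. complex_of_real (\<rho> x) * f x)) \<le> e * B)"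

lemma cutoff_zero: "0 \<le> e \<Longrightarrow> cutoff e (\<lambda>x. 0)"
  unfolding cutoff_def
proof (intro conjI allI impI)
  fix f :: "'a \<Rightarrow> complex" and B
  assume "0 \<le> e" "\<forall>x. cmod (f x) \<le> B"
  then have "0 \<le> e * B" by (meson mult_nonneg_nonneg norm_ge_zero order_trans)
  then show "cmod (\<Phi> (\<lambda>x. complex_of_real 0 * f x)) \<le> e * B"
    using functional_scale[of "\<lambda>x. 0" 0] by simp
qed auto

text \<open>In terms of the representing measure, \<open>cutoff e \<rho>\<close> says that
  \<open>\<rho>\<close> has integral at most \<open>e\<close> against its total variation. The
  combination is \<open>1 - (1 - \<rho> x) * (1 - \<sigma> x)\<close>: it stays in the unit interval
  and equals 1 wherever either factor does. Errors add because \<open>(1 - \<rho> x) * f x\<close>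
  obeys the same bound as \<open>f\<close>.\<close>

lemma cutoff_combine:
  assumes "cutoff a \<rho>" "cutoff b \<sigma>"
  shows "cutoff (a + b) (\<lambda>x. \<rho> x + \<sigma> x * (1 - \<rho> x))"
  unfolding cutoff_def
proof (intro conjI allI impI)
  have \<rho>: "continuous_on UNIV \<rho>" and \<rho>01: "\<And>x. 0 \<le> \<rho> x \<and> \<rho> x \<le> 1"
    and \<sigma>: "continuous_on UNIV \<sigma>" and \<sigma>01: "\<And>x. 0 \<le> \<sigma> x \<and> \<sigma> x \<le> 1"
    using assms unfolding cutoff_def by auto
  show "continuous_on UNIV (\<lambda>x. \<rho> x + \<sigma> x * (1 - \<rho> x))" by (intro continuous_intros \<rho> \<sigma>)
  show "0 \<le> \<rho> x + \<sigma> x * (1 - \<rho> x)" for x using \<rho>01[of x] \<sigma>01[of x] by simp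
  have "\<sigma> x * (1 - \<rho> x) \<le> 1 * (1 - \<rho> x)" for x using \<rho>01[of x] \<sigma>01[of x] by (intro mult_right_mono) auto
  then show "\<rho> x + \<sigma> x * (1 - \<rho> x) \<le> 1" for x by (simp add: algebra_simps)
  fix f :: "'a \<Rightarrow> complex" and B
  assume f: "continuous_on UNIV f" "\<forall>x. cmod (f x) \<le> B"
  define g where "g x = complex_of_real (1 - \<rho> x) * f x" for x
  have g: "continuous_on UNIV g" unfolding g_def by (intro continuous_intros \<rho> f)
  have "cmod (g x) \<le> 1 * B" for x
    unfolding g_def norm_mult norm_of_real using \<rho>01[of x] f(2) by (intro mult_mono) auto
  then have 2: "cmod (\<Phi> (\<lambda>x. complex_of_real (\<sigma> x) * g x)) \<le> b * B"
    using assms(2) g unfolding cutoff_def by simp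
  have 1: "cmod (\<Phi> (\<lambda>x. complex_of_real (\<rho> x) * f x)) \<le> a * B"
    using assms(1) f unfolding cutoff_def by blast
  have "\<Phi> (\<lambda>x. complex_of_real (\<rho> x + \<sigma> x * (1 - \<rho> x)) * f x) =
      \<Phi> (\<lambda>x. complex_of_real (\<rho> x) * f x + complex_of_real (\<sigma> x) * g x)"
    unfolding g_def by (simp add: algebra_simps)
  also have "\<dots> = \<Phi> (\<lambda>x. complex_of_real (\<rho> x) * f x) + \<Phi> (\<lambda>x. complex_of_real (\<sigma> x) * g x)"
    by (intro functional_add continuous_intros \<rho> \<sigma> f g)
  finally show "cmod (\<Phi> (\<lambda>x. complex_of_real (\<rho> x + \<sigma> x * (1 - \<rho> x)) * f x)) \<le> (a + b) * B"
    using 1 2 norm_triangle_mono unfolding distrib_right by metis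
qed

text \<open>Each point \<open>p\<close> contributes a bump supported in a set of variation at most
  \<open>e / 2\<close> inside the translate of \<open>W\<close> by \<open>p\<close>; the other half
  of \<open>e\<close> is left for the remaining points, so \<open>e\<close> must vary in the
  induction.\<close>

lemma cutoff_finite:
  assumes "finite X" "open W" "0 \<in> W" "e > 0"
  shows "\<exists>\<rho> N. cutoff e \<rho> \<and> open N \<and> 0 \<in> N \<and> (\<forall>x\<in>X. \<exists>y. y - x \<in> W \<and> (\<forall>z\<in>N. \<rho> (y + z) = 1))"
  using assms(1,4)
proof (induction X arbitrary: e)
  case empty
  then show ?case by (intro exI[of _ "\<lambda>x. 0"] exI[of _ UNIV]) (simp add: cutoff_zero)
next
  case (insert p X)
  have "e / 2 > 0" using insert.prems by simp
  from insert.IH[OF this] obtain \<rho> N where \<rho>: "cutoff (e / 2) \<rho>" "open N" "0 \<in> N"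
      "\<And>x. x \<in> X \<Longrightarrow> \<exists>y. y - x \<in> W \<and> (\<forall>z\<in>N. \<rho> (y + z) = 1)" by blast
  have "open ((\<lambda>y. - p + y) -` W)" by (rule open_translate[OF assms(2)])
  moreover have "p \<in> (\<lambda>y. - p + y) -` W" using assms(3) by simp
  ultimately obtain V where V: "open V" "V \<noteq> {}" "V \<subseteq> (\<lambda>y. - p + y) -` W" "variation_le V (e / 2)"
    using variation_small[OF _ _ \<open>e / 2 > 0\<close>] by (metis empty_iff)
  obtain y where y: "y \<in> V" using V(2) by blast
  obtain \<sigma> :: "'a \<Rightarrow> real" and M where \<sigma>: "continuous_on UNIV \<sigma>" "\<forall>x. 0 \<le> \<sigma> x \<and> \<sigma> x \<le> 1"
    "\<forall>x. x \<notin> V \<longrightarrow> \<sigma> x = 0" "open M" "0 \<in> M" "\<forall>z\<in>M. \<sigma> (y + z) = 1"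
    using bump_function[OF V(1) y] by blast
  have "cutoff (e / 2) \<sigma>"
    unfolding cutoff_def
  proof (intro conjI allI impI)
    show "continuous_on UNIV \<sigma>" "0 \<le> \<sigma> x" "\<sigma> x \<le> 1" for x using \<sigma>(1,2) by auto
    fix f :: "'a \<Rightarrow> complex" and B
    assume f: "continuous_on UNIV f" "\<forall>x. cmod (f x) \<le> B"
    have "cmod (complex_of_real (\<sigma> x) * f x) \<le> 1 * B" for x
      unfolding norm_mult using \<sigma>(2) f(2) by (intro mult_mono) auto
    moreover have "continuous_on UNIV (\<lambda>x. complex_of_real (\<sigma> x) * f x)"
      by (intro continuous_intros \<sigma> f)
    ultimately show "cmod (\<Phi> (\<lambda>x. complex_of_real (\<sigma> x) * f x)) \<le> e / 2 * B"
      using V(4) \<sigma>(3) unfolding variation_le_def by simp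
  qed
  from cutoff_combine[OF \<rho>(1) this]
  have "cutoff e (\<lambda>x. \<rho> x + \<sigma> x * (1 - \<rho> x))" by simp
  moreover have "\<exists>y. y - x \<in> W \<and> (\<forall>z\<in>N \<inter> M. \<rho> (y + z) + \<sigma> (y + z) * (1 - \<rho> (y + z)) = 1)"
    if "x \<in> insert p X" for x
  proof (cases "x = p")
    case True
    then have "y - x \<in> W" using V(3) y by auto
    then show ?thesis using \<sigma>(6) by (intro exI[of _ y]) auto
  next
    case False
    then have "x \<in> X" using that by simp
    then obtain y where "y - x \<in> W" "\<forall>z\<in>N. \<rho> (y + z) = 1" using \<rho>(4) by blast
    then show ?thesis by (intro exI[of _ y]) auto
  qed
  ultimately show ?case using \<rho>(2,3) \<sigma>(4,5)
    by (intro exI[of _ "\<lambda>x. \<rho> x + \<sigma> x * (1 - \<rho> x)"] exI[of _ "N \<inter> M"]) auto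
qed

text \<open>Compactness reduces all \<open>v\<close> to a finite net, and the net error is absorbed
  because sums of two elements of \<open>O1\<close> lie in \<open>W\<close>. Symmetry of
  \<open>N\<close> and the inclusion of \<open>N + N\<close> in \<open>W\<close> make the
  intersection of iterated neighbourhoods a subgroup.\<close>

lemma cutoff_step:
  assumes "open W" "0 \<in> W" "e > 0"
  shows "\<exists>\<rho> N. cutoff e \<rho> \<and> open N \<and> 0 \<in> N \<and> (\<forall>a\<in>N. - a \<in> N) \<and> (\<forall>a\<in>N. \<forall>b\<in>N. a + b \<in> W) \<and>
     (\<forall>v. \<exists>y. y - v \<in> W \<and> (\<forall>z\<in>N. \<rho> (y + z) = 1))"
proof -
  obtain O1 where O1: "open O1" "0 \<in> O1" "O1 \<subseteq> W" "\<forall>a\<in>O1. - a \<in> O1"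
    "\<forall>a\<in>O1. \<forall>b\<in>O1. a + b \<in> W"
    using zero_neighbourhood[OF assms(1,2)] by blast
  obtain X where X: "finite X" "UNIV \<subseteq> (\<Union>x\<in>X. (\<lambda>v. - x + v) -` O1)"
  proof (rule compactE_image[OF compact_group, of UNIV "\<lambda>x. (\<lambda>v. - x + v) -` O1"])
    show "UNIV \<subseteq> (\<Union>x. (\<lambda>v. - x + v) -` O1)"
    proof
      fix v show "v \<in> (\<Union>x. (\<lambda>v. - x + v) -` O1)"
        using O1(2) by (intro UN_I[of v]) auto
    qed
  qed (use open_translate[OF O1(1)] in blast)+
  obtain \<rho> M where \<rho>: "cutoff e \<rho>" "open M" "0 \<in> M"
      "\<And>x. x \<in> X \<Longrightarrow> \<exists>y. y - x \<in> O1 \<and> (\<forall>z\<in>M. \<rho> (y + z) = 1)"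
    using cutoff_finite[OF X(1) O1(1,2) assms(3)] by blast
  obtain N where N: "open N" "0 \<in> N" "N \<subseteq> M \<inter> O1" "\<forall>a\<in>N. - a \<in> N"
    using zero_neighbourhood[OF open_Int[OF \<rho>(2) O1(1)]] \<rho>(3) O1(2) by blast
  have "\<exists>y. y - v \<in> W \<and> (\<forall>z\<in>N. \<rho> (y + z) = 1)" for v
  proof -
    obtain x where x: "x \<in> X" "- x + v \<in> O1" using X(2) by blast
    obtain y where y: "y - x \<in> O1" "\<forall>z\<in>M. \<rho> (y + z) = 1" using \<rho>(4)[OF x(1)] by blast
    \<comment> \<open>This element is \<open>y - v\<close>, written as a sum of two members of the
      symmetric set \<open>O1\<close>.\<close>
    have "(y - x) + (- (- x + v)) \<in> W" using O1(4,5) x(2) y(1) by blast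
    then show ?thesis using y(2) N(3) by (intro exI[of _ y]) (auto simp: algebra_simps)
  qed
  moreover have "a + b \<in> W" if "a \<in> N" "b \<in> N" for a b using that N(3) O1(5) by blast
  ultimately show ?thesis using \<rho>(1) N by (intro exI[of _ \<rho>] exI[of _ N]) blast
qed

text \<open>An open set need not contain a set from a given countable family, as \<open>G\<close> need not be
  metrizable. But let \<open>H\<close> be the intersection of the neighbourhoods \<open>N k\<close> built below, a closed subgroup.
  For open \<open>V\<close> the set \<open>V + H\<close> contains some \<open>v + N k\<close> by compactness, hence a translate \<open>y + H\<close> on which
  \<open>\<rho> k = 1\<close>, and then \<open>V\<close> itself meets \<open>y + H\<close>.\<close>

lemma cutoff_sequence:
  fixes e :: "nat \<Rightarrow> real"
  assumes "\<And>n. e n > 0"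
  obtains \<rho> where "\<And>n. cutoff (e n) (\<rho> n)"
    "\<And>V. open V \<Longrightarrow> V \<noteq> {} \<Longrightarrow> \<exists>W k. open W \<and> W \<noteq> {} \<and> W \<subseteq> V \<and> (\<forall>x\<in>W. \<rho> k x = 1)"
proof -
  define P where "P n W \<rho> N \<longleftrightarrow> cutoff (e n) \<rho> \<and> open N \<and> 0 \<in> N \<and> (\<forall>a\<in>N. - a \<in> N) \<and>
     (\<forall>a\<in>N. \<forall>b\<in>N. a + b \<in> W) \<and> (\<forall>v. \<exists>y. y - v \<in> W \<and> (\<forall>z\<in>N. \<rho> (y + z) = 1))"
    for n and W :: "'a set" and \<rho> N
  \<comment> \<open>Stage \<open>n\<close> takes \<open>N n\<close> as its \<open>W\<close> and
    returns \<open>N (Suc n)\<close>, so \<open>y k\<close> is only \<open>N k\<close>-close to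
    \<open>v\<close> while the plateau of \<open>\<rho> k\<close> has the size of
    \<open>N (Suc k)\<close>.\<close>
  have "\<exists>f. \<forall>n. (open (f n) \<and> 0 \<in> f n) \<and> (\<exists>\<rho>. P n (f n) \<rho> (f (Suc n)))"
  proof (rule dependent_nat_choice)
    show "\<exists>x :: 'a set. open x \<and> 0 \<in> x" by (intro exI[of _ UNIV]) simp
    show "\<exists>N. (open N \<and> 0 \<in> N) \<and> (\<exists>\<rho>. P n W \<rho> N)" if W: "open W \<and> 0 \<in> W" for W n
      using cutoff_step[of W "e n"] W assms unfolding P_def by blast
  qed
  then obtain N where N: "\<And>n. open (N n)" "\<And>n. 0 \<in> N n"
    and "\<forall>n. \<exists>\<rho>. P n (N n) \<rho> (N (Suc n))" by blast
  then obtain \<rho> where P: "\<And>n. P n (N n) (\<rho> n) (N (Suc n))" by metis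
  have cut: "cutoff (e n) (\<rho> n)" for n using P unfolding P_def by blast
  have N_add: "a + b \<in> N n" if "a \<in> N (Suc n)" "b \<in> N (Suc n)" for a b n
    using P[of n] that unfolding P_def by blast
  have N_neg: "- a \<in> N (Suc n)" if "a \<in> N (Suc n)" for a n
    using P[of n] that unfolding P_def by blast
  have N_anti: "N j \<subseteq> N i" if "i \<le> j" for i j
  proof -
    have "N (Suc n) \<subseteq> N n" for n using N_add[OF _ N(2)] by force
    then show ?thesis using lift_Suc_antimono_le[of N] that by blast
  qed
  have "\<exists>W k. open W \<and> W \<noteq> {} \<and> W \<subseteq> V \<and> (\<forall>x\<in>W. \<rho> k x = 1)" if V: "open V" "V \<noteq> {}" for V
  proof -
    obtain v where v: "v \<in> V" using V by blast
    have "\<forall>k. \<exists>y. y - v \<in> N k \<and> (\<forall>z\<in>N (Suc k). \<rho> k (y + z) = 1)"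
      using P unfolding P_def by blast
    then obtain y where y: "\<And>k. y k - v \<in> N k" "\<And>k z. z \<in> N (Suc k) \<Longrightarrow> \<rho> k (y k + z) = 1" by metis
    \<comment> \<open>a cluster point of \<open>y k - v\<close> lies in \<open>H\<close>\<close>
    define F where "F = filtermap (\<lambda>k. y k - v) sequentially"
    have "F \<noteq> bot" unfolding F_def by (simp add: filtermap_bot_iff)
    \<comment> \<open>A cluster point of the filter is used because a sequence in a non-metrizable
      compact group may have no convergent subsequence.\<close>
    then obtain c where c: "inf (nhds c) F \<noteq> bot"
      using compact_group unfolding compact_filter by auto
    have freq: "\<exists>j\<ge>k. y j - v \<in> U" if "open U" "c \<in> U" for U k
    proof (rule ccontr)
      assume "\<not> (\<exists>j\<ge>k. y j - v \<in> U)"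
      then have "eventually (\<lambda>d. d \<notin> U) F"
        unfolding F_def eventually_filtermap eventually_sequentially by blast
      moreover have "eventually (\<lambda>d. d \<in> U) (nhds c)" using that by (rule eventually_nhds_in_open)
      ultimately have "eventually (\<lambda>d. False) (inf (nhds c) F)"
        unfolding eventually_inf by blast
      then show False using c by (simp add: trivial_limit_def)
    qed
    \<comment> \<open>Some late \<open>y j - v\<close> lies in \<open>N (Suc k)\<close> and differs
      from \<open>c\<close> by an element of \<open>N (Suc k)\<close>; the difference of the two
      elements costs one index.\<close>
    have c_N: "c \<in> N k" for k
    proof -
      have "open ((\<lambda>d. - c + d) -` N (Suc k))" by (rule open_translate[OF N(1)])
      moreover have "c \<in> (\<lambda>d. - c + d) -` N (Suc k)" using N(2) by simp
      ultimately obtain j where j: "j \<ge> Suc k" "- c + (y j - v) \<in> N (Suc k)" using freq by blast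
      have "y j - v \<in> N (Suc k)" using y(1)[of j] N_anti[OF j(1)] by blast
      then have "(y j - v) + (- (- c + (y j - v))) \<in> N k" by (intro N_add N_neg j)
      then show ?thesis by simp
    qed
    have "open ((\<lambda>d. (v - c) + d) -` V)" by (rule open_translate[OF V(1)])
    moreover have "c \<in> (\<lambda>d. (v - c) + d) -` V" using v by simp
    ultimately obtain j where "(v - c) + (y j - v) \<in> V" using freq by blast
    \<comment> \<open>The point \<open>y j - c\<close> is \<open>v\<close> shifted by the small
      element \<open>(y j - v) - c\<close>, so it lies in \<open>V\<close>; since \<open>c\<close>
      is in every \<open>N k\<close>, it also lies on the plateau of
      \<open>\<rho> j\<close>.\<close>
    then have mem: "y j + (- c) \<in> V" by (simp add: algebra_simps)
    define W where "W = V \<inter> (\<lambda>x. - y j + x) -` N (Suc j)"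
    have "open W" unfolding W_def by (intro open_Int V open_translate N)
    moreover have "y j + (- c) \<in> W" unfolding W_def using mem N_neg[OF c_N] by simp
    moreover have "\<rho> j x = 1" if "x \<in> W" for x
      using y(2)[of "- y j + x" j] that unfolding W_def by simp
    moreover have "W \<subseteq> V" unfolding W_def by blast
    ultimately show ?thesis by blast
  qed
  with cut show thesis by (rule that)
qed

end

section \<open>Modification of a function on a set of small variation\<close>

text \<open>A continuous substitute for \<open>cnj w / cmod w\<close>.\<close>

definition soft_sign :: "real \<Rightarrow> complex \<Rightarrow> complex" where
  "soft_sign \<eta> w = cnj w / complex_of_real (max (cmod w) \<eta>)"

lemma continuous_on_soft_sign:
  "0 < \<eta> \<Longrightarrow> continuous_on S g \<Longrightarrow> continuous_on S (\<lambda>x. soft_sign \<eta> (g x))"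
  unfolding soft_sign_def by (intro continuous_intros) (auto simp: max_def)

lemma norm_soft_sign_le: "0 < \<eta> \<Longrightarrow> cmod (soft_sign \<eta> w) \<le> 1"
  by (simp add: soft_sign_def norm_divide max_def)

text \<open>The product is the squared modulus of \<open>w\<close> divided by
  \<open>max (cmod w) \<eta>\<close>: exactly \<open>cmod w\<close> above the threshold, and below
  it the left side is nonpositive.\<close>

lemma mult_soft_sign_ge:
  assumes "0 < \<eta>"
  shows "cmod w - \<eta> \<le> Re (w * soft_sign \<eta> w)"
proof -
  define M where "M = max (cmod w) \<eta>"
  have M: "M > 0" "cmod w \<le> M" "M \<le> cmod w + \<eta>" using assms by (auto simp: M_def)
  have "w * soft_sign \<eta> w = complex_of_real ((cmod w)\<^sup>2 / M)"
    unfolding soft_sign_def M_def[symmetric] using complex_norm_square[of w] by simp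
  then have eq: "Re (w * soft_sign \<eta> w) = (cmod w)\<^sup>2 / M" by (simp only: Re_complex_of_real)
  have "(cmod w - \<eta>) * M \<le> (cmod w)\<^sup>2"
  proof (cases "cmod w \<le> \<eta>")
    case True
    then have "(cmod w - \<eta>) * M \<le> 0" using M(1) by (simp add: mult_nonpos_nonneg)
    then show ?thesis using zero_le_power2 order_trans by blast
  next
    case False
    then have "(cmod w - \<eta>) * M \<le> (cmod w - \<eta>) * (cmod w + \<eta>)"
      using M by (intro mult_left_mono) auto
    also have "\<dots> \<le> (cmod w)\<^sup>2" by (simp add: algebra_simps power2_eq_square)
    finally show ?thesis .
  qed
  then show ?thesis unfolding eq using M(1) by (simp add: pos_le_divide_eq)
qed

context compact_haar_group
begin

section \<open>\<open>C_spec\<close> as a subspace, and norming by its annihilator\<close>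

lemma fourier_coeff_add:
  assumes "continuous_on UNIV f" "continuous_on UNIV g" "\<gamma> \<in> dual_group"
  shows "fourier_coeff m (\<lambda>x. f x + g x) \<gamma> = fourier_coeff m f \<gamma> + fourier_coeff m g \<gamma>"
proof -
  have "continuous_on UNIV \<gamma>" using assms(3) by (simp add: dual_group_def)
  then show ?thesis unfolding fourier_coeff_def distrib_right
    by (intro Bochner_Integration.integral_add integrable_continuous continuous_intros assms)
qed

lemma fourier_coeff_scale: "fourier_coeff m (\<lambda>x. c * f x) \<gamma> = c * fourier_coeff m f \<gamma>"
  unfolding fourier_coeff_def by (simp add: mult.assoc)

lemma C_spec_zero: "0 \<in> C_spec m \<Lambda>"
  by (simp add: C_spec_def fourier_coeff_def)

lemma C_spec_add: "f \<in> C_spec m \<Lambda> \<Longrightarrow> g \<in> C_spec m \<Lambda> \<Longrightarrow> f + g \<in> C_spec m \<Lambda>"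
  by (auto simp: C_spec_def fourier_coeff_add)

lemma C_spec_scale: "f \<in> C_spec m \<Lambda> \<Longrightarrow> scaleC_bcontfun c f \<in> C_spec m \<Lambda>"
proof -
  have "apply_bcontfun (scaleC_bcontfun c f) = (\<lambda>x. c * apply_bcontfun f x)" by (rule ext) simp
  then show "f \<in> C_spec m \<Lambda> \<Longrightarrow> scaleC_bcontfun c f \<in> C_spec m \<Lambda>"
    by (simp add: C_spec_def fourier_coeff_scale)
qed

lemma C_spec_uminus: "f \<in> C_spec m \<Lambda> \<Longrightarrow> - f \<in> C_spec m \<Lambda>"
proof -
  have "- f = scaleC_bcontfun (-1) f" by (rule bcontfun_eqI) simp
  then show "f \<in> C_spec m \<Lambda> \<Longrightarrow> - f \<in> C_spec m \<Lambda>" using C_spec_scale by metis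
qed

lemma C_spec_annihilator:
  assumes "h \<in> C_spec m \<Lambda>" "g \<in> annihilator \<Lambda>"
  shows "(\<integral>x. g x * apply_bcontfun h x \<partial>m) = 0"
proof -
  have "AE x in m. cmod (apply_bcontfun h x) \<le> norm h" by (simp add: norm_bounded)
  moreover have "apply_bcontfun h \<in> borel_measurable m" by (rule measurable_continuous) auto
  ultimately have "apply_bcontfun h \<in> Linfty_spec m \<Lambda>"
    using assms(1) unfolding Linfty_spec_def Linfty_def C_spec_def by auto
  then show ?thesis using assms(2) unfolding annihilator_def by blast
qed

text \<open>Contrapositive of \<open>rosenthal_approximation\<close>, with \<open>g\<close> rotated
  to make the integral real. Positivity of the L1 norm follows from strictness, as the integral of
  \<open>g * f\<close> is at most \<open>B\<close> times that norm. Measurable \<open>f\<close> are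
  allowed because both \<open>z\<close> and the discontinuous \<open>Y + z\<close> are
  treated.\<close>

lemma annihilator_norming:
  fixes f :: "'a \<Rightarrow> complex"
  assumes "rosenthal_set m \<Lambda>" and f: "f \<in> borel_measurable m" and fB: "\<And>x. cmod (f x) \<le> B"
    and d: "0 \<le> d"
    and no: "\<And>h. h \<in> C_spec m \<Lambda> \<Longrightarrow> \<not> (AE x in m. cmod (f x - apply_bcontfun h x) \<le> d)"
  obtains g where "g \<in> annihilator \<Lambda>" "0 < (\<integral>x. cmod (g x) \<partial>m)"
    "d * (\<integral>x. cmod (g x) \<partial>m) < Re (\<integral>x. g x * f x \<partial>m)"
proof -
  have "\<exists>g\<in>annihilator \<Lambda>. d * (\<integral>x. cmod (g x) \<partial>m) < cmod (\<integral>x. g x * f x \<partial>m)"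
  proof (rule ccontr)
    assume neg: "\<not> ?thesis"
    show False
      by (rule rosenthal_approximation[OF assms(1) f fB d]) (use neg no in \<open>auto simp: not_less\<close>)
  qed
  then obtain g where g: "g \<in> annihilator \<Lambda>"
    and less: "d * (\<integral>x. cmod (g x) \<partial>m) < cmod (\<integral>x. g x * f x \<partial>m)" by blast
  have g_cont: "continuous_on UNIV g" using g by (simp add: annihilator_def)
  have g_int: "integrable m g" by (rule integrable_continuous[OF g_cont])
  define w where "w = (\<integral>x. g x * f x \<partial>m)"
  obtain c where c1: "cmod c = 1" and c: "c * w = cmod w" using unimodular_rotation .
  have "f \<in> Linfty m" using f fB unfolding Linfty_def by auto
  then have gf_int: "integrable m (\<lambda>x. g x * f x)" by (rule Linfty_integrable_mult[OF g_cont])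
  have "0 < (\<integral>x. cmod (g x) \<partial>m)"
  proof (rule ccontr)
    assume "\<not> ?thesis"
    then have 0: "(\<integral>x. cmod (g x) \<partial>m) = 0"
      using Bochner_Integration.integral_nonneg[of m "\<lambda>x. cmod (g x)"] by fastforce
    have "cmod w \<le> (\<integral>x. cmod (g x * f x) \<partial>m)"
      unfolding w_def by (rule integral_norm_bound)
    also have "\<dots> \<le> (\<integral>x. B * cmod (g x) \<partial>m)"
      using fB g_int
      by (intro integral_mono integrable_norm[OF gf_int])
        (auto simp: norm_mult mult.commute[of B] mult_left_mono)
    also have "\<dots> = 0" using 0 by simp
    finally show False using less 0 by (simp add: w_def)
  qed
  moreover have "Re (\<integral>x. (c * g x) * f x \<partial>m) = cmod w"
    using c unfolding w_def by (simp add: mult.assoc)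
  ultimately show thesis
    using less by (intro that[OF annihilator_scale[OF g, of c]]) (auto simp: norm_mult c1 w_def)
qed

end

context continuous_functional
begin

lemma cutoff_mono:
  assumes "cutoff a \<rho>" "a \<le> b"
  shows "cutoff b \<rho>"
  unfolding cutoff_def
proof (intro conjI allI impI)
  show "continuous_on UNIV \<rho>" "0 \<le> \<rho> x" "\<rho> x \<le> 1" for x
    using assms(1) unfolding cutoff_def by auto
  fix f :: "'a \<Rightarrow> complex" and B
  assume f: "continuous_on UNIV f" "\<forall>x. cmod (f x) \<le> B"
  have "0 \<le> B" using f(2) norm_ge_zero order_trans by blast
  have "cmod (\<Phi> (\<lambda>x. complex_of_real (\<rho> x) * f x)) \<le> a * B"
    using assms(1) f unfolding cutoff_def by blast
  also have "\<dots> \<le> b * B" using assms(2) \<open>0 \<le> B\<close> by (intro mult_right_mono)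
  finally show "cmod (\<Phi> (\<lambda>x. complex_of_real (\<rho> x) * f x)) \<le> b * B" .
qed

text \<open>The errors \<open>\<epsilon> / 2 ^ Suc n\<close> sum to less than
  \<open>\<epsilon>\<close>, so every finite combination \<open>r n\<close> remains an
  \<open>\<epsilon>\<close>-cutoff. The complementary products decrease, hence \<open>r n\<close>
  converges pointwise, and one vanishing factor forces the value 1 from then on.\<close>

lemma cutoff_limit:
  assumes "\<epsilon> > 0"
  obtains r :: "nat \<Rightarrow> 'a \<Rightarrow> real" and R :: "'a \<Rightarrow> real" where "\<And>n. cutoff \<epsilon> (r n)"
    "\<And>x. (\<lambda>n. r n x) \<longlonglongrightarrow> R x" "R \<in> borel_measurable m" "\<And>x. 0 \<le> R x \<and> R x \<le> 1"
    "\<And>V. open V \<Longrightarrow> V \<noteq> {} \<Longrightarrow> \<exists>W. open W \<and> W \<noteq> {} \<and> W \<subseteq> V \<and> (\<forall>x\<in>W. R x = 1)"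
proof -
  define e where "e n = \<epsilon> / 2 ^ Suc n" for n :: nat
  have e_pos: "e n > 0" for n using assms by (simp add: e_def)
  obtain \<rho> where cut: "\<And>n. cutoff (e n) (\<rho> n)"
    and dense: "\<And>V. open V \<Longrightarrow> V \<noteq> {} \<Longrightarrow> \<exists>W k. open W \<and> W \<noteq> {} \<and> W \<subseteq> V \<and> (\<forall>x\<in>W. \<rho> k x = 1)"
    using cutoff_sequence[of e] e_pos by blast
  define r where "r n x = 1 - (\<Prod>i<n. 1 - \<rho> i x)" for n x
  have r_Suc: "r (Suc n) = (\<lambda>x. r n x + \<rho> n x * (1 - r n x))" for n
    by (auto simp: r_def fun_eq_iff algebra_simps)
  have sum_e: "(\<Sum>i<n. e i) = \<epsilon> * (1 - 1 / 2 ^ n)" for n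
    by (induction n) (auto simp: e_def field_simps)
  have "cutoff (\<Sum>i<n. e i) (r n)" for n
  proof (induction n)
    case 0
    then show ?case using cutoff_zero[of 0] by (simp add: r_def)
  next
    case (Suc n)
    then show ?case unfolding r_Suc using cutoff_combine[OF Suc cut[of n]] by simp
  qed
  then have r_cut: "cutoff \<epsilon> (r n)" for n
    by (rule cutoff_mono) (use assms in \<open>simp add: sum_e algebra_simps\<close>)
  have r_cont: "continuous_on UNIV (r n)" and r_01: "0 \<le> r n x" "r n x \<le> 1" for n x
    using r_cut[of n] unfolding cutoff_def by auto
  have \<rho>_01: "0 \<le> \<rho> n x" "\<rho> n x \<le> 1" for n x
    using cut[of n] unfolding cutoff_def by auto
  have "\<exists>L. (\<lambda>n. r n x) \<longlonglongrightarrow> L" for x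
  proof -
    have "incseq (\<lambda>n. r n x)"
      using r_01 \<rho>_01 by (intro incseq_SucI) (simp add: r_Suc)
    from incseq_convergent[OF this, of 1] r_01 show ?thesis by metis
  qed
  then obtain R where R: "\<And>x. (\<lambda>n. r n x) \<longlonglongrightarrow> R x" by metis
  have "R \<in> borel_measurable m"
    by (rule borel_measurable_LIMSEQ_real[of m r]) (auto intro: R measurable_continuous r_cont)
  moreover have "0 \<le> R x \<and> R x \<le> 1" for x
    using LIMSEQ_le_const[OF R[of x], of 0] LIMSEQ_le_const2[OF R[of x], of 1] r_01 by auto
  moreover have R_1: "R x = 1" if k: "\<rho> k x = 1" for k x
  proof -
    have "r n x = 1" if "n \<ge> Suc k" for n
    proof -
      have "(\<Prod>i<n. 1 - \<rho> i x) = 0"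
        using that k by (intro prod_zero) auto
      then show ?thesis by (simp add: r_def)
    qed
    then have "eventually (\<lambda>n. r n x = 1) sequentially"
      unfolding eventually_sequentially by blast
    then have "(\<lambda>n. r n x) \<longlonglongrightarrow> 1" by (rule tendsto_eventually)
    then show ?thesis using R LIMSEQ_unique by blast
  qed
  moreover have "\<exists>W. open W \<and> W \<noteq> {} \<and> W \<subseteq> V \<and> (\<forall>x\<in>W. R x = 1)" if "open V" "V \<noteq> {}" for V
    using dense[OF that] R_1 by meson
  ultimately show thesis using that[of r R] r_cut R by blast
qed

lemma modification:
  fixes x0 z :: "'a \<Rightarrow>\<^sub>C complex"
  assumes ros: "rosenthal_set m \<Lambda>" and x0: "norm x0 \<le> 1" and "0 < D"
    and dist: "\<And>h. h \<in> C_spec m \<Lambda> \<Longrightarrow> D \<le> norm (z + h)" and "0 < \<epsilon>"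
  obtains x :: "'a \<Rightarrow>\<^sub>C complex" where "norm x \<le> 1"
    "cmod (\<Phi> (apply_bcontfun x) - \<Phi> (apply_bcontfun x0)) \<le> \<epsilon>"
    "\<And>h. h \<in> C_spec m \<Lambda> \<Longrightarrow> 1 + D - \<epsilon> \<le> norm (x + z + h)"
proof -
  define Z where "Z = apply_bcontfun z"
  define X0 where "X0 = apply_bcontfun x0"
  have Z_cont: "continuous_on UNIV Z" and X0_cont: "continuous_on UNIV X0"
    unfolding Z_def X0_def by auto
  have X0_le: "cmod (X0 x) \<le> 1" for x
    unfolding X0_def using norm_bounded[of x0 x] x0 by simp
  have Z_le: "cmod (Z x) \<le> norm z" for x unfolding Z_def by (rule norm_bounded)
  \<comment> \<open>Three losses of \<open>\<delta>\<close> are budgeted: norming \<open>z\<close>,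
    the soft sign, and a strict margin for the mean of \<open>q\<close>. The bound by
    \<open>D / 3\<close> keeps the thresholds \<open>D - \<delta>\<close> and
    \<open>1 + D - 3 * \<delta>\<close> nonnegative.\<close>
  define \<delta> where "\<delta> = min (\<epsilon> / 4) (D / 3)"
  have \<delta>: "0 < \<delta>" "4 * \<delta> \<le> \<epsilon>" "\<delta> < D" "3 * \<delta> \<le> D" using assms(3,5) by (auto simp: \<delta>_def)
  obtain g where g: "g \<in> annihilator \<Lambda>" and c_pos: "0 < (\<integral>x. cmod (g x) \<partial>m)"
    and gZ: "(D - \<delta>) * (\<integral>x. cmod (g x) \<partial>m) < Re (\<integral>x. g x * Z x \<partial>m)"
  proof (rule annihilator_norming[OF ros measurable_continuous[OF Z_cont] Z_le, of "D - \<delta>"])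
    fix h assume h: "h \<in> C_spec m \<Lambda>"
    show "\<not> (AE x in m. cmod (Z x - apply_bcontfun h x) \<le> D - \<delta>)"
    proof
      assume "AE x in m. cmod (Z x - apply_bcontfun h x) \<le> D - \<delta>"
      moreover have "continuous_on UNIV (\<lambda>x. cmod (Z x - apply_bcontfun h x))"
        by (intro continuous_intros Z_cont) auto
      ultimately have "cmod (Z x - apply_bcontfun h x) \<le> D - \<delta>" for x
        using AE_continuous_le by blast
      then have "norm (z + (- h)) \<le> D - \<delta>"
        by (intro norm_bound) (simp add: Z_def)
      with dist[OF C_spec_uminus[OF h]] \<delta> show False by simp
    qed
  qed (use \<delta> in auto)
  define c where "c = (\<integral>x. cmod (g x) \<partial>m)"
  have c: "c > 0" using c_pos by (simp add: c_def)
  have g_cont: "continuous_on UNIV g" using g by (simp add: annihilator_def)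
  \<comment> \<open>As \<open>m\<close> is a probability measure, the soft sign loses at most
    \<open>\<eta>\<close> in the mean, which is \<open>\<delta>\<close> relative to
    \<open>c\<close>.\<close>
  define \<eta> where "\<eta> = \<delta> * c"
  have \<eta>: "\<eta> > 0" using c \<delta> by (simp add: \<eta>_def)
  define s where "s x = soft_sign \<eta> (g x)" for x
  have s_cont: "continuous_on UNIV s"
    unfolding s_def by (rule continuous_on_soft_sign[OF \<eta> g_cont])
  have s_le: "cmod (s x) \<le> 1" for x unfolding s_def by (rule norm_soft_sign_le[OF \<eta>])
  have gs: "cmod (g x) - \<eta> \<le> Re (g x * s x)" for x unfolding s_def by (rule mult_soft_sign_ge[OF \<eta>])
  \<comment> \<open>The cutoffs multiply \<open>s - X0\<close>, of modulus at most 2, hence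
    \<open>\<epsilon> / 2\<close>.\<close>
  obtain r :: "nat \<Rightarrow> 'a \<Rightarrow> real" and R :: "'a \<Rightarrow> real" where r_cut: "\<And>n. cutoff (\<epsilon> / 2) (r n)"
    and R: "\<And>x. (\<lambda>n. r n x) \<longlonglongrightarrow> R x" and R_meas: "R \<in> borel_measurable m"
    and R_01: "\<And>x. 0 \<le> R x \<and> R x \<le> 1"
    and dense: "\<And>V. open V \<Longrightarrow> V \<noteq> {} \<Longrightarrow> \<exists>W. open W \<and> W \<noteq> {} \<and> W \<subseteq> V \<and> (\<forall>x\<in>W. R x = 1)"
    using cutoff_limit[of "\<epsilon> / 2"] assms(5) by (metis half_gt_zero)
  have r_cont: "continuous_on UNIV (r n)" and r_01: "0 \<le> r n x" "r n x \<le> 1" for n x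
    using r_cut[of n] unfolding cutoff_def by auto
  define X where "X n x = X0 x + complex_of_real (r n x) * (s x - X0 x)" for n x
  define Y where "Y x = X0 x + complex_of_real (R x) * (s x - X0 x)" for x
  have convex: "cmod (X0 x + complex_of_real t * (s x - X0 x)) \<le> 1" if "0 \<le> t" "t \<le> 1" for t x
  proof -
    have "X0 x + complex_of_real t * (s x - X0 x) = (1 - t) *\<^sub>R X0 x + t *\<^sub>R s x"
      by (simp add: scaleR_conv_of_real algebra_simps)
    also have "cmod \<dots> \<le> (1 - t) * 1 + t * 1"
      using that X0_le[of x] s_le[of x]
      by (intro order_trans[OF norm_triangle_ineq] add_mono) (auto simp: mult_left_le)
    finally show ?thesis by simp
  qed
  have X_cont: "continuous_on UNIV (X n)" for n
    unfolding X_def by (intro continuous_intros X0_cont s_cont r_cont)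
  have X_le: "cmod (X n x) \<le> 1" for n x unfolding X_def using r_01 by (intro convex) auto
  have Y_le: "cmod (Y x) \<le> 1" for x unfolding Y_def using R_01 by (intro convex) auto
  have X_Y: "(\<lambda>n. X n x) \<longlonglongrightarrow> Y x" for x
    unfolding X_def Y_def by (intro tendsto_intros R)
  have Y_meas [measurable]: "Y \<in> borel_measurable m"
    unfolding Y_def using R_meas measurable_continuous[OF X0_cont] measurable_continuous[OF s_cont]
    by measurable
  have Z_meas [measurable]: "Z \<in> borel_measurable m" by (rule measurable_continuous[OF Z_cont])

  \<comment> \<open>\<open>Y = s\<close> on a dense open set, so for each \<open>h\<close> it suffices that the continuous function \<open>q\<close> is
    positive somewhere, which follows from its positive mean\<close>
  have far: "\<not> (AE x in m. cmod (Y x + Z x - apply_bcontfun h x) \<le> 1 + D - 3 * \<delta>)"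
    if h: "h \<in> C_spec m \<Lambda>" for h
  proof
    assume ae: "AE x in m. cmod (Y x + Z x - apply_bcontfun h x) \<le> 1 + D - 3 * \<delta>"
    define H where "H = apply_bcontfun h"
    have H_cont: "continuous_on UNIV H" unfolding H_def by auto
    \<comment> \<open>Where \<open>Y\<close> equals \<open>s\<close>, positivity of \<open>q\<close>
      contradicts the bound in \<open>ae\<close>. The \<open>H\<close> term drops out of the mean
      because \<open>g\<close> annihilates it, so positivity somewhere holds whatever
      \<open>h\<close> is.\<close>
    define q where "q x = Re (g x * (s x + Z x - H x)) - (1 + D - 3 * \<delta>) * cmod (g x)" for x
    have q_cont: "continuous_on UNIV q"
      unfolding q_def by (intro continuous_intros g_cont s_cont Z_cont H_cont)
    have int: "integrable m (\<lambda>x. g x * s x)" "integrable m (\<lambda>x. g x * Z x)"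
        "integrable m (\<lambda>x. g x * H x)" "integrable m g"
      by (intro integrable_continuous continuous_intros g_cont s_cont Z_cont H_cont)+
    have "(\<integral>x. q x \<partial>m) =
        (\<integral>x. Re (g x * s x) + Re (g x * Z x) - Re (g x * H x) - (1 + D - 3 * \<delta>) * cmod (g x) \<partial>m)"
      unfolding q_def by (simp add: algebra_simps)
    also have "\<dots> = (\<integral>x. Re (g x * s x) \<partial>m) + Re (\<integral>x. g x * Z x \<partial>m) - Re (\<integral>x. g x * H x \<partial>m)
        - (1 + D - 3 * \<delta>) * c"
      using int by (simp add: c_def del: times_complex.sel minus_complex.sel)
    also have "(\<integral>x. g x * H x \<partial>m) = 0"
      unfolding H_def by (rule C_spec_annihilator[OF h g])
    finally have q_int: "(\<integral>x. q x \<partial>m) = (\<integral>x. Re (g x * s x) \<partial>m) + Re (\<integral>x. g x * Z x \<partial>m)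
        - (1 + D - 3 * \<delta>) * c" by simp
    have "(\<integral>x. cmod (g x) - \<eta> \<partial>m) \<le> (\<integral>x. Re (g x * s x) \<partial>m)"
      using int gs by (intro integral_mono) (auto simp del: times_complex.sel)
    then have "c - \<eta> \<le> (\<integral>x. Re (g x * s x) \<partial>m)"
      using int(4) by (simp add: c_def)
    then have "c - \<eta> + (D - \<delta>) * c - (1 + D - 3 * \<delta>) * c < (\<integral>x. q x \<partial>m)"
      using gZ q_int unfolding c_def[symmetric] by linarith
    moreover have "c - \<eta> + (D - \<delta>) * c - (1 + D - 3 * \<delta>) * c = \<delta> * c"
      by (simp add: \<eta>_def algebra_simps)
    ultimately have "0 < (\<integral>x. q x \<partial>m)" using \<delta> c by (metis less_trans mult_pos_pos)
    have "{x. 0 < q x} \<noteq> {}"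
    proof
      assume "{x. 0 < q x} = {}"
      then have "q x \<le> 0" for x by (metis empty_iff mem_Collect_eq not_le)
      then have "(\<integral>x. q x \<partial>m) \<le> 0" using Bochner_Integration.integral_nonneg[of m "\<lambda>x. - q x"] by simp
      with \<open>0 < (\<integral>x. q x \<partial>m)\<close> show False by simp
    qed
    moreover have "open {x. 0 < q x}" by (intro open_Collect_less q_cont) auto
    ultimately obtain W where W: "open W" "W \<noteq> {}" "W \<subseteq> {x. 0 < q x}" "\<forall>x\<in>W. R x = 1"
      using dense by meson
    obtain x where x: "x \<in> W" "cmod (Y x + Z x - apply_bcontfun h x) \<le> 1 + D - 3 * \<delta>"
      using AE_open[OF ae W(1,2)] by blast
    have "R x = 1" using W(4) x(1) by blast
    then have Y_s: "Y x = s x" by (simp add: Y_def)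
    have "(1 + D - 3 * \<delta>) * cmod (g x) < Re (g x * (s x + Z x - H x))"
      using W(3) x(1) by (auto simp: q_def)
    also have "\<dots> \<le> cmod (g x) * cmod (s x + Z x - H x)"
      using complex_Re_le_cmod[of "g x * (s x + Z x - H x)"] by (simp only: norm_mult)
    also have "\<dots> \<le> cmod (g x) * (1 + D - 3 * \<delta>)"
      using x(2) by (intro mult_left_mono) (auto simp: Y_s H_def)
    finally show False by (simp add: mult.commute)
  qed
  have YZ_le: "cmod (Y x + Z x) \<le> 1 + norm z" for x
    by (intro order_trans[OF norm_triangle_ineq] add_mono Y_le Z_le)
  obtain g' where g': "g' \<in> annihilator \<Lambda>" and c'_pos: "0 < (\<integral>x. cmod (g' x) \<partial>m)"
    and g'Y: "(1 + D - 3 * \<delta>) * (\<integral>x. cmod (g' x) \<partial>m) < Re (\<integral>x. g' x * (Y x + Z x) \<partial>m)"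
  proof (rule annihilator_norming[OF ros _ YZ_le])
    show "(\<lambda>x. Y x + Z x) \<in> borel_measurable m" by measurable
    show "0 \<le> 1 + D - 3 * \<delta>" using \<delta> by simp
  qed (use far in auto)
  have g'_cont: "continuous_on UNIV g'" using g' by (simp add: annihilator_def)
  have [measurable]: "g' \<in> borel_measurable m" "\<And>n. X n \<in> borel_measurable m"
    using measurable_continuous g'_cont X_cont by blast+
  have g'_int: "integrable m g'" by (rule integrable_continuous[OF g'_cont])
  have "(\<lambda>n. \<integral>x. g' x * (X n x + Z x) \<partial>m) \<longlonglongrightarrow> (\<integral>x. g' x * (Y x + Z x) \<partial>m)"
  proof (rule integral_dominated_convergence[where w = "\<lambda>x. cmod (g' x) * (1 + norm z)"])
    show "integrable m (\<lambda>x. cmod (g' x) * (1 + norm z))" using g'_int by simp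
    show "AE x in m. (\<lambda>n. g' x * (X n x + Z x)) \<longlonglongrightarrow> g' x * (Y x + Z x)"
      by (intro AE_I2 tendsto_intros X_Y)
    show "AE x in m. cmod (g' x * (X n x + Z x)) \<le> cmod (g' x) * (1 + norm z)" for n
      unfolding norm_mult
      by (intro AE_I2 mult_left_mono order_trans[OF norm_triangle_ineq] add_mono X_le Z_le) auto
  qed measurable
  then have "(\<lambda>n. Re (\<integral>x. g' x * (X n x + Z x) \<partial>m)) \<longlonglongrightarrow> Re (\<integral>x. g' x * (Y x + Z x) \<partial>m)"
    by (rule tendsto_Re)
  \<comment> \<open>The stage \<open>n\<close> is fixed here, before any \<open>h\<close> is chosen;
    this is what the passage through \<open>g'\<close> achieves.\<close>
  from order_tendstoD(1)[OF this g'Y]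
  obtain n where n: "(1 + D - 3 * \<delta>) * (\<integral>x. cmod (g' x) \<partial>m) < Re (\<integral>x. g' x * (X n x + Z x) \<partial>m)"
    by (auto dest!: eventually_happens)
  have Xn: "apply_bcontfun (Bcontfun (X n)) = X n"
    by (rule Bcontfun_inverse[OF continuous_bcontfun[OF X_cont]])
  show thesis
  proof (rule that[of "Bcontfun (X n)"])
    show "norm (Bcontfun (X n)) \<le> 1"
      by (rule norm_bound) (simp add: Xn X_le)
    have diff_cont: "continuous_on UNIV (\<lambda>x. s x - X0 x)" by (intro continuous_intros s_cont X0_cont)
    have "cmod (s x - X0 x) \<le> 2" for x
      using norm_triangle_ineq4[of "s x" "X0 x"] s_le[of x] X0_le[of x] by linarith
    then have "cmod (\<Phi> (\<lambda>x. complex_of_real (r n x) * (s x - X0 x))) \<le> \<epsilon> / 2 * 2"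
      using r_cut[of n] diff_cont unfolding cutoff_def by blast
    moreover have "\<Phi> (X n) = \<Phi> X0 + \<Phi> (\<lambda>x. complex_of_real (r n x) * (s x - X0 x))"
      unfolding X_def by (intro functional_add continuous_intros X0_cont r_cont s_cont)
    ultimately show "cmod (\<Phi> (apply_bcontfun (Bcontfun (X n))) - \<Phi> (apply_bcontfun x0)) \<le> \<epsilon>"
      unfolding Xn X0_def[symmetric] by simp
    show "1 + D - \<epsilon> \<le> norm (Bcontfun (X n) + z + h)" if h: "h \<in> C_spec m \<Lambda>" for h
    proof -
      define H where "H = apply_bcontfun h"
      define B where "B = norm (Bcontfun (X n) + z + h)"
      have H_cont: "continuous_on UNIV H" unfolding H_def by auto
      have B: "cmod (X n x + Z x + H x) \<le> B" for x
        using norm_bounded[of "Bcontfun (X n) + z + h" x] by (simp add: Xn Z_def H_def B_def)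
      have int: "integrable m (\<lambda>x. g' x * (X n x + Z x))" "integrable m (\<lambda>x. g' x * H x)"
        by (intro integrable_continuous continuous_intros g'_cont X_cont Z_cont H_cont)+
      have "(\<integral>x. g' x * (X n x + Z x + H x) \<partial>m) = (\<integral>x. g' x * (X n x + Z x) + g' x * H x \<partial>m)"
        by (simp add: distrib_left)
      also have "\<dots> = (\<integral>x. g' x * (X n x + Z x) \<partial>m) + (\<integral>x. g' x * H x \<partial>m)"
        using int by (rule Bochner_Integration.integral_add)
      also have "(\<integral>x. g' x * H x \<partial>m) = 0"
        unfolding H_def by (rule C_spec_annihilator[OF h g'])
      finally have "Re (\<integral>x. g' x * (X n x + Z x) \<partial>m) \<le> cmod (\<integral>x. g' x * (X n x + Z x + H x) \<partial>m)"
        using complex_Re_le_cmod by simp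
      also have "\<dots> \<le> (\<integral>x. cmod (g' x * (X n x + Z x + H x)) \<partial>m)" by (rule integral_norm_bound)
      also have "\<dots> \<le> (\<integral>x. B * cmod (g' x) \<partial>m)"
      proof (rule integral_mono)
        show "integrable m (\<lambda>x. cmod (g' x * (X n x + Z x + H x)))"
          by (intro integrable_norm integrable_continuous continuous_intros g'_cont X_cont Z_cont H_cont)
        show "cmod (g' x * (X n x + Z x + H x)) \<le> B * cmod (g' x)" for x
          unfolding norm_mult mult.commute[of "cmod (g' x)"] by (intro mult_right_mono B) auto
      qed (use g'_int in simp)
      finally have "(1 + D - 3 * \<delta>) * (\<integral>x. cmod (g' x) \<partial>m) < B * (\<integral>x. cmod (g' x) \<partial>m)"
        using n by simp
      then have "1 + D - 3 * \<delta> < B" using c'_pos by simp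
      then show ?thesis using \<delta> unfolding B_def by linarith
    qed
  qed
qed

end

section \<open>Quotients of \<open>C(G)\<close>\<close>

lemma scaleC_bcontfun_simps:
  fixes f g :: "'a::topological_space \<Rightarrow>\<^sub>C complex"
  shows "scaleC_bcontfun c (f + g) = scaleC_bcontfun c f + scaleC_bcontfun c g"
    and "scaleC_bcontfun (c + d) f = scaleC_bcontfun c f + scaleC_bcontfun d f"
    and "scaleC_bcontfun c (scaleC_bcontfun d f) = scaleC_bcontfun (c * d) f"
    and "scaleC_bcontfun 1 f = f" and "scaleC_bcontfun (-1) f = - f" and "scaleC_bcontfun 0 f = 0"
    and "scaleC_bcontfun c (f - g) = scaleC_bcontfun c f - scaleC_bcontfun c g"
    and "scaleC_bcontfun (c - d) f = scaleC_bcontfun c f - scaleC_bcontfun d f"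
  by (auto intro!: bcontfun_eqI simp: algebra_simps)

lemma norm_scaleC_bcontfun:
  fixes f :: "'a::topological_space \<Rightarrow>\<^sub>C complex"
  shows "norm (scaleC_bcontfun c f) = cmod c * norm f"
proof (rule antisym)
  have le: "norm (scaleC_bcontfun c f) \<le> cmod c * norm f" for c and f :: "'a \<Rightarrow>\<^sub>C complex"
    by (rule norm_bound) (auto simp: norm_mult intro!: mult_left_mono norm_bounded)
  then show "norm (scaleC_bcontfun c f) \<le> cmod c * norm f" .
  show "cmod c * norm f \<le> norm (scaleC_bcontfun c f)"
  proof (cases "c = 0")
    case False
    have "norm f = norm (scaleC_bcontfun (1 / c) (scaleC_bcontfun c f))"
      using False by (simp add: scaleC_bcontfun_simps)
    also have "\<dots> \<le> cmod (1 / c) * norm (scaleC_bcontfun c f)" by (rule le)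
    finally show ?thesis using False by (simp add: norm_divide field_simps)
  qed simp
qed

text \<open>The library proves completeness of the bounded continuous functions for metric domains only.\<close>

lemma bcontfun_geometric_limit:
  fixes f :: "nat \<Rightarrow> 'a::topological_space \<Rightarrow>\<^sub>C complex"
  assumes "\<And>k. norm (f (Suc k) - f k) < (1 / 2) ^ k"
  shows "\<exists>l. f \<longlonglongrightarrow> l"
proof -
  define D where "D k = apply_bcontfun (f (Suc k) - f k)" for k
  have D_le: "norm (D k x) \<le> (1 / 2) ^ k" for k x
    using norm_bounded[of "f (Suc k) - f k" x] assms[of k] unfolding D_def by linarith
  have "(\<Sum>i<n. D i x) = apply_bcontfun (f n - f 0) x" for n x
    by (induction n) (auto simp: D_def)
  moreover have "uniform_limit UNIV (\<lambda>n x. \<Sum>i<n. D i x) (\<lambda>x. suminf (\<lambda>i. D i x)) sequentially"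
    by (rule Weierstrass_m_test[where M = "\<lambda>k. (1 / 2) ^ k"]) (auto intro: D_le)
  ultimately have "uniform_limit UNIV (\<lambda>n. apply_bcontfun (f n - f 0)) (\<lambda>x. suminf (\<lambda>i. D i x)) sequentially"
    by simp
  then obtain l where "(\<lambda>n. f n - f 0) \<longlonglongrightarrow> l"
    using uniform_limit_bcontfunE[OF _ sequentially_bot] by metis
  then have "(\<lambda>n. (f n - f 0) + f 0) \<longlonglongrightarrow> l + f 0" by (intro tendsto_intros)
  then show ?thesis by auto
qed

locale closed_C_subspace =
  fixes M :: "('a::topological_space \<Rightarrow>\<^sub>C complex) set"
  assumes M_zero: "0 \<in> M" and M_add: "f \<in> M \<Longrightarrow> g \<in> M \<Longrightarrow> f + g \<in> M"
    and M_scale: "f \<in> M \<Longrightarrow> scaleC_bcontfun c f \<in> M" and M_closed: "closed M"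
begin

lemma M_uminus: "f \<in> M \<Longrightarrow> - f \<in> M"
  using M_scale[of f "-1"] by (simp add: scaleC_bcontfun_simps)

abbreviation "Q \<equiv> quotient_space C_space M"
abbreviation "coset \<equiv> vcoset C_space M"

text \<open>Since \<open>M\<close> is closed under negation, this is the distance of
  \<open>x\<close> to \<open>M\<close>; the form with a plus sign matches the norms over a
  coset.\<close>

definition qnorm :: "('a \<Rightarrow>\<^sub>C complex) \<Rightarrow> real" where
  "qnorm x = (INF h\<in>M. norm (x + h))"

lemma coset_eq: "coset x = coset y \<longleftrightarrow> x - y \<in> M"
proof
  assume "coset x = coset y"
  moreover have "x \<in> coset x" unfolding vcoset_def C_space_def using M_zero by force
  ultimately have "x \<in> coset y" by simp
  then show "x - y \<in> M" unfolding vcoset_def C_space_def by auto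
next
  assume d: "x - y \<in> M"
  have "coset a \<subseteq> coset b" if "a - b \<in> M" for a b
  proof
    fix u assume "u \<in> coset a"
    then obtain h where h: "h \<in> M" "u = a + h" unfolding vcoset_def C_space_def by auto
    then have "u = b + ((a - b) + h)" by simp
    moreover have "(a - b) + h \<in> M" by (intro M_add that h)
    ultimately have "u \<in> (+) b ` M" by (rule image_eqI)
    then show "u \<in> coset b" unfolding vcoset_def C_space_def by simp
  qed
  moreover have "y - x \<in> M" using M_uminus[OF d] by simp
  ultimately show "coset x = coset y" using d by blast
qed

lemma Q_carrier: "vcarrier Q = range coset"
  unfolding quotient_space_def C_space_def by simp

lemma Q_zero: "vzero Q = coset 0"
  unfolding quotient_space_def vcoset_def C_space_def by simp

lemma Q_add: "vadd Q (coset x) (coset y) = coset (x + y)"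
proof -
  have "{a + b |a b. a \<in> (+) x ` M \<and> b \<in> (+) y ` M} = (+) (x + y) ` M"
  proof (intro equalityI subsetI)
    fix u assume "u \<in> {a + b |a b. a \<in> (+) x ` M \<and> b \<in> (+) y ` M}"
    then obtain g h where "g \<in> M" "h \<in> M" "u = (x + g) + (y + h)" by auto
    then show "u \<in> (+) (x + y) ` M"
      using M_add by (intro image_eqI[of _ _ "g + h"]) (auto simp: algebra_simps)
  next
    fix u assume "u \<in> (+) (x + y) ` M"
    then obtain h where "h \<in> M" "u = (x + 0) + (y + h)" by (auto simp: algebra_simps)
    then show "u \<in> {a + b |a b. a \<in> (+) x ` M \<and> b \<in> (+) y ` M}" using M_zero by blast
  qed
  then show ?thesis unfolding quotient_space_def vcoset_def C_space_def by simp
qed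

lemma Q_scale: "vscale Q c (coset x) = coset (scaleC_bcontfun c x)"
proof -
  have "{scaleC_bcontfun c a + y |a y. a \<in> (+) x ` M \<and> y \<in> M} = (+) (scaleC_bcontfun c x) ` M"
  proof (intro equalityI subsetI)
    fix u assume "u \<in> {scaleC_bcontfun c a + y |a y. a \<in> (+) x ` M \<and> y \<in> M}"
    then obtain g h where "g \<in> M" "h \<in> M" "u = scaleC_bcontfun c (x + g) + h" by auto
    then show "u \<in> (+) (scaleC_bcontfun c x) ` M"
      using M_add M_scale
      by (intro image_eqI[of _ _ "scaleC_bcontfun c g + h"]) (auto simp: scaleC_bcontfun_simps algebra_simps)
  next
    fix u assume "u \<in> (+) (scaleC_bcontfun c x) ` M"
    then obtain h where h: "h \<in> M" "u = scaleC_bcontfun c (x + 0) + h" by auto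
    then show "u \<in> {scaleC_bcontfun c a + y |a y. a \<in> (+) x ` M \<and> y \<in> M}" using M_zero by blast
  qed
  then show ?thesis unfolding quotient_space_def vcoset_def C_space_def by simp
qed

lemma Q_norm: "vnorm Q (coset x) = qnorm x"
  unfolding quotient_space_def vcoset_def C_space_def qnorm_def by (simp add: image_image)

lemma Q_diff: "vdiff Q (coset x) (coset y) = coset (x - y)"
  unfolding vdiff_def Q_scale Q_add by (simp add: scaleC_bcontfun_simps)

lemma bdd_below_norms: "bdd_below ((\<lambda>h. norm (x + h)) ` M)"
  by (rule bdd_belowI2[of _ 0]) simp

lemma qnorm_le: "h \<in> M \<Longrightarrow> qnorm x \<le> norm (x + h)"
  unfolding qnorm_def by (rule cINF_lower[OF bdd_below_norms])

lemma qnorm_le_norm: "qnorm x \<le> norm x"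
  using qnorm_le[OF M_zero] by simp

lemma qnorm_ge: "(\<And>h. h \<in> M \<Longrightarrow> r \<le> norm (x + h)) \<Longrightarrow> r \<le> qnorm x"
  unfolding qnorm_def using M_zero by (intro cINF_greatest) auto

lemma qnorm_less: "qnorm x < r \<Longrightarrow> \<exists>h\<in>M. norm (x + h) < r"
  using qnorm_ge[of r x] by (meson not_le)

lemma qnorm_nonneg: "0 \<le> qnorm x"
  by (rule qnorm_ge) simp

lemma qnorm_cong: "x - y \<in> M \<Longrightarrow> qnorm x = qnorm y"
  using coset_eq[of x y] Q_norm by metis

lemma qnorm_triangle: "qnorm (x + y) \<le> qnorm x + qnorm y"
proof (rule field_le_epsilon)
  fix e :: real assume "e > 0"
  then obtain g h where gh: "g \<in> M" "h \<in> M" "norm (x + g) < qnorm x + e / 2" "norm (y + h) < qnorm y + e / 2"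
    using qnorm_less[of x "qnorm x + e / 2"] qnorm_less[of y "qnorm y + e / 2"] by auto
  have "qnorm (x + y) \<le> norm (x + y + (g + h))" by (rule qnorm_le[OF M_add[OF gh(1,2)]])
  also have "x + y + (g + h) = (x + g) + (y + h)" by simp
  also have "norm \<dots> \<le> norm (x + g) + norm (y + h)" by (rule norm_triangle_ineq)
  finally show "qnorm (x + y) \<le> qnorm x + qnorm y + e" using gh by linarith
qed

lemma qnorm_scale: "qnorm (scaleC_bcontfun c x) = cmod c * qnorm x"
proof (rule antisym)
  have le: "qnorm (scaleC_bcontfun c x) \<le> cmod c * qnorm x" if "c \<noteq> 0" for c x
  proof -
    have "qnorm (scaleC_bcontfun c x) / cmod c \<le> qnorm x"
    proof (rule qnorm_ge)
      fix h assume "h \<in> M"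
      then have "qnorm (scaleC_bcontfun c x) \<le> norm (scaleC_bcontfun c x + scaleC_bcontfun c h)"
        by (intro qnorm_le M_scale)
      also have "\<dots> = cmod c * norm (x + h)"
        by (simp add: scaleC_bcontfun_simps(1)[symmetric] norm_scaleC_bcontfun)
      finally show "qnorm (scaleC_bcontfun c x) / cmod c \<le> norm (x + h)"
        using that by (simp add: field_simps)
    qed
    then show ?thesis using that by (simp add: field_simps)
  qed
  have zero: "qnorm 0 = 0" using qnorm_le_norm[of 0] qnorm_nonneg[of 0] by simp
  show "qnorm (scaleC_bcontfun c x) \<le> cmod c * qnorm x"
    using le zero by (cases "c = 0") (auto simp: scaleC_bcontfun_simps)
  show "cmod c * qnorm x \<le> qnorm (scaleC_bcontfun c x)"
  proof (cases "c = 0")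
    case False
    have "qnorm x = qnorm (scaleC_bcontfun (1 / c) (scaleC_bcontfun c x))"
      using False by (simp add: scaleC_bcontfun_simps)
    also have "\<dots> \<le> cmod (1 / c) * qnorm (scaleC_bcontfun c x)" using False by (intro le) simp
    finally show ?thesis using False by (simp add: norm_divide field_simps)
  qed (simp add: qnorm_nonneg)
qed

text \<open>Vanishing distance places \<open>x\<close> in the closure of \<open>M\<close>;
  closedness of \<open>M\<close> finishes.\<close>

lemma qnorm_eq_zero: "qnorm x = 0 \<longleftrightarrow> x \<in> M"
proof
  assume 0: "qnorm x = 0"
  have "x \<in> closure M"
    unfolding closure_approachable
  proof (intro allI impI)
    fix e :: real assume "e > 0"
    then obtain h where "h \<in> M" "norm (x + h) < e" using qnorm_less[of x e] 0 by auto
    then show "\<exists>y\<in>M. dist y x < e"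
      using M_uminus by (intro bexI[of _ "- h"]) (auto simp: dist_norm norm_minus_commute)
  qed
  then show "x \<in> M" using M_closed by simp
next
  assume "x \<in> M"
  then show "qnorm x = 0" using qnorm_le[OF M_uminus, of x x] qnorm_nonneg[of x] by simp
qed

section \<open>The quotient as a Banach space\<close>

lemma quotient_normed: "complex_normed_space Q"
proof
  fix A B C c d
  show "vzero Q \<in> vcarrier Q" by (simp add: Q_zero Q_carrier)
  assume "A \<in> vcarrier Q"
  then obtain a where a: "A = coset a" unfolding Q_carrier by blast
  show "vscale Q c A \<in> vcarrier Q" by (simp add: a Q_scale Q_carrier)
  show "vadd Q A (vzero Q) = A" by (simp add: a Q_zero Q_add)
  show "vdiff Q A A = vzero Q" by (simp add: a Q_zero Q_diff)
  show "vscale Q (c + d) A = vadd Q (vscale Q c A) (vscale Q d A)"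
    by (simp add: a Q_scale Q_add scaleC_bcontfun_simps)
  show "vscale Q c (vscale Q d A) = vscale Q (c * d) A" "vscale Q 1 A = A"
    by (simp_all add: a Q_scale scaleC_bcontfun_simps)
  show "0 \<le> vnorm Q A" by (simp add: a Q_norm qnorm_nonneg)
  show "vnorm Q A = 0 \<longleftrightarrow> A = vzero Q"
    by (simp add: a Q_norm Q_zero qnorm_eq_zero coset_eq)
  show "vnorm Q (vscale Q c A) = cmod c * vnorm Q A" by (simp add: a Q_norm Q_scale qnorm_scale)
  assume "B \<in> vcarrier Q"
  then obtain b where b: "B = coset b" unfolding Q_carrier by blast
  show "vadd Q A B \<in> vcarrier Q" by (simp add: a b Q_add Q_carrier)
  show "vadd Q A B = vadd Q B A" by (simp add: a b Q_add add.commute)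
  show "vscale Q c (vadd Q A B) = vadd Q (vscale Q c A) (vscale Q c B)"
    by (simp add: a b Q_add Q_scale scaleC_bcontfun_simps)
  show "vnorm Q (vadd Q A B) \<le> vnorm Q A + vnorm Q B"
    by (simp add: a b Q_add Q_norm qnorm_triangle)
  assume "C \<in> vcarrier Q"
  then obtain c' where c': "C = coset c'" unfolding Q_carrier by blast
  show "vadd Q (vadd Q A B) C = vadd Q A (vadd Q B C)"
    by (simp add: a b c' Q_add add.assoc)
qed

text \<open>A rapidly Cauchy subsequence is lifted to representatives \<open>y k\<close> whose
  consecutive distances are geometric in C(G) itself. Their limit there yields the limit of the
  cosets, and the Cauchy property carries the full sequence along.\<close>

lemma quotient_complete:
  fixes x :: "nat \<Rightarrow> 'a \<Rightarrow>\<^sub>C complex"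
  assumes cauchy: "\<And>e. e > 0 \<Longrightarrow> \<exists>N. \<forall>i\<ge>N. \<forall>j\<ge>N. qnorm (x i - x j) < e"
  shows "\<exists>l. (\<lambda>n. qnorm (x n - l)) \<longlonglongrightarrow> 0"
proof -
  have "\<forall>k. \<exists>N. \<forall>i\<ge>N. \<forall>j\<ge>N. qnorm (x i - x j) < (1 / 2) ^ k"
    using cauchy by simp
  then obtain N0 where N0: "\<And>k i j. i \<ge> N0 k \<Longrightarrow> j \<ge> N0 k \<Longrightarrow> qnorm (x i - x j) < (1 / 2) ^ k"
    by metis
  \<comment> \<open>Summation makes the thresholds monotone while keeping each above
    \<open>N0 k\<close>, so consecutive indices both exceed \<open>N0 k\<close>.\<close>
  define N where "N k = (\<Sum>i\<le>k. N0 i)" for k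
  have N_ge: "N0 k \<le> N k" "N k \<le> N (Suc k)" for k
    unfolding N_def by (auto intro: member_le_sum)
  have "\<exists>y. \<forall>k. y k - x (N k) \<in> M \<and> norm (y (Suc k) - y k) < (1 / 2) ^ k"
  proof (rule dependent_nat_choice)
    show "\<exists>y. y - x (N 0) \<in> M" by (intro exI[of _ "x (N 0)"]) (simp add: M_zero)
    fix y k assume y: "y - x (N k) \<in> M"
    have "qnorm (x (N (Suc k)) - y) = qnorm (x (N (Suc k)) - x (N k))"
      using M_uminus[OF y] by (intro qnorm_cong) simp
    also have "\<dots> < (1 / 2) ^ k" using N_ge[of k] by (intro N0) auto
    finally obtain h where "h \<in> M" "norm (x (N (Suc k)) - y + h) < (1 / 2) ^ k"
      using qnorm_less by blast
    then show "\<exists>y'. y' - x (N (Suc k)) \<in> M \<and> norm (y' - y) < (1 / 2) ^ k"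
      by (intro exI[of _ "x (N (Suc k)) + h"]) (simp add: algebra_simps)
  qed
  then obtain y where y: "\<And>k. y k - x (N k) \<in> M" "\<And>k. norm (y (Suc k) - y k) < (1 / 2) ^ k" by blast
  obtain l where l: "y \<longlonglongrightarrow> l" using bcontfun_geometric_limit[of y] y(2) by blast
  have "(\<lambda>n. qnorm (x n - l)) \<longlonglongrightarrow> 0"
  proof (rule LIMSEQ_I)
    fix e :: real assume e: "e > 0"
    have "eventually (\<lambda>k. norm (y k - l) < e / 2) sequentially"
      using l e unfolding tendsto_iff dist_norm by (meson half_gt_zero)
    moreover have "(\<lambda>k. (1 / 2 :: real) ^ k) \<longlonglongrightarrow> 0" by (intro LIMSEQ_realpow_zero) auto
    then have "eventually (\<lambda>k. (1 / 2) ^ k < e / 2) sequentially"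
      using e by (intro order_tendstoD(2)) auto
    ultimately have "eventually (\<lambda>k. norm (y k - l) < e / 2 \<and> (1 / 2) ^ k < e / 2) sequentially"
      by (rule eventually_conj)
    then obtain k where k: "norm (y k - l) < e / 2" "(1 / 2) ^ k < e / 2"
      by (auto dest!: eventually_happens)
    have "norm (qnorm (x n - l) - 0) < e" if "n \<ge> N k" for n
    proof -
      have "qnorm (x n - l) = qnorm ((x n - x (N k)) + (x (N k) - l))" by simp
      also have "\<dots> \<le> qnorm (x n - x (N k)) + qnorm (x (N k) - l)" by (rule qnorm_triangle)
      also have "qnorm (x n - x (N k)) < (1 / 2) ^ k" using N_ge(1)[of k] that by (intro N0) auto
      also have "qnorm (x (N k) - l) = qnorm (y k - l)"
        using M_uminus[OF y(1)[of k]] by (intro qnorm_cong) simp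
      also have "\<dots> \<le> norm (y k - l)" by (rule qnorm_le_norm)
      finally show ?thesis using k qnorm_nonneg[of "x n - l"] by simp
    qed
    then show "\<exists>n0. \<forall>n\<ge>n0. norm (qnorm (x n - l) - 0) < e" by blast
  qed
  then show ?thesis by blast
qed

lemma quotient_banach: "complex_banach_space Q"
proof -
  interpret complex_normed_space Q by (rule quotient_normed)
  show ?thesis
  proof
    fix s :: "nat \<Rightarrow> ('a \<Rightarrow>\<^sub>C complex) set"
    assume s: "\<And>n. s n \<in> vcarrier Q"
      and cauchy: "\<And>e. e > 0 \<Longrightarrow> \<exists>N. \<forall>m\<ge>N. \<forall>n\<ge>N. vnorm Q (vdiff Q (s m) (s n)) < e"
    have "\<forall>n. \<exists>x. s n = coset x" using s unfolding Q_carrier by blast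
    then obtain x where x: "\<And>n. s n = coset (x n)" by metis
    obtain l where "(\<lambda>n. qnorm (x n - l)) \<longlonglongrightarrow> 0"
      using quotient_complete[of x] cauchy unfolding x Q_diff Q_norm by blast
    then show "\<exists>l\<in>vcarrier Q. (\<lambda>n. vnorm Q (vdiff Q (s n) l)) \<longlonglongrightarrow> 0"
      unfolding x Q_carrier by (intro bexI[of _ "coset l"]) (auto simp: Q_diff Q_norm)
  qed
qed

end

section \<open>The Daugavet property of the quotient\<close>

lemma (in compact_haar_group) fourier_coeff_le:
  assumes "\<gamma> \<in> dual_group"
  shows "cmod (fourier_coeff m (apply_bcontfun f) \<gamma>) \<le> norm f"
proof -
  have \<gamma>: "continuous_on UNIV \<gamma>" "\<And>x. cmod (\<gamma> x) = 1" using assms by (auto simp: dual_group_def)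
  have "integrable m (\<lambda>x. apply_bcontfun f x * cnj (\<gamma> x))"
    by (intro integrable_continuous continuous_intros \<gamma>) auto
  from integrable_norm[OF this]
  have "cmod (fourier_coeff m (apply_bcontfun f) \<gamma>) \<le> (\<integral>x. norm f \<partial>m)"
    unfolding fourier_coeff_def
    by (intro order_trans[OF integral_norm_bound] integral_mono) (auto simp: norm_mult \<gamma> norm_bounded)
  then show ?thesis by simp
qed

text \<open>Each Fourier coefficient is a contraction for the supremum norm, so its zero set is
  closed.\<close>

lemma (in compact_haar_group) closed_C_spec: "closed (C_spec m \<Lambda>)"
proof -
  have "f \<in> C_spec m \<Lambda>" if f: "f \<in> closure (C_spec m \<Lambda>)" for f
    unfolding C_spec_def
  proof (intro CollectI ballI)
    fix \<gamma> :: "'a \<Rightarrow> complex" assume \<gamma>: "\<gamma> \<in> dual_group - \<Lambda>"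
    have "cmod (fourier_coeff m (apply_bcontfun f) \<gamma>) \<le> 0"
    proof (rule field_le_epsilon)
      fix e :: real assume "e > 0"
      then obtain g where g: "g \<in> C_spec m \<Lambda>" "dist g f < e"
        using f unfolding closure_approachable by blast
      have "fourier_coeff m (\<lambda>x. apply_bcontfun (f - g) x + apply_bcontfun g x) \<gamma> =
          fourier_coeff m (apply_bcontfun (f - g)) \<gamma> + fourier_coeff m (apply_bcontfun g) \<gamma>"
        by (rule fourier_coeff_add) (use \<gamma> in \<open>auto simp del: minus_bcontfun.rep_eq\<close>)
      moreover have "(\<lambda>x. apply_bcontfun (f - g) x + apply_bcontfun g x) = apply_bcontfun f" by auto
      ultimately have "fourier_coeff m (apply_bcontfun f) \<gamma> =
          fourier_coeff m (apply_bcontfun (f - g)) \<gamma> + fourier_coeff m (apply_bcontfun g) \<gamma>"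
        by (simp only:)
      also have "\<dots> = fourier_coeff m (apply_bcontfun (f - g)) \<gamma>"
        using g(1) \<gamma> by (simp add: C_spec_def)
      finally show "cmod (fourier_coeff m (apply_bcontfun f) \<gamma>) \<le> 0 + e"
        using fourier_coeff_le[of \<gamma> "f - g"] \<gamma> g(2) by (simp add: dist_norm norm_minus_commute)
    qed
    then show "fourier_coeff m (apply_bcontfun f) \<gamma> = 0" by simp
  qed
  then show ?thesis using closure_subset_eq by blast
qed

theorem corollary6p3:
  fixes m :: "'a::{topological_ab_group_add, t2_space} measure"
    and \<Lambda> :: "('a \<Rightarrow> complex) set"
  assumes "compact (UNIV :: 'a set)"
    and "infinite (UNIV :: 'a set)"
    and "normalized_haar_measure m"
    and "\<Lambda> \<subseteq> dual_group"
    and "rosenthal_set m \<Lambda>"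
  shows "daugavet_property (quotient_space C_space (C_spec m \<Lambda>))"
proof -
  interpret compact_haar_group m by (rule compact_haar_group.intro[OF assms(1-3)])
  interpret closed_C_subspace "C_spec m \<Lambda>"
    by standard (use C_spec_zero C_spec_add C_spec_scale closed_C_spec in auto)
  have "op_norm Q (\<lambda>x. vadd Q x (T x)) = 1 + op_norm Q T"
    if T: "bounded_op Q T" and T1: "rank_one Q T" for T
  proof -
    obtain y where y: "coset y \<noteq> coset 0" and T_range: "T ` vcarrier Q = range (\<lambda>c. vscale Q c (coset y))"
      using T1 unfolding rank_one_def Q_carrier Q_zero by blast
    define N where "N = op_norm Q T"
    define p where "p = qnorm y"
    have p: "p > 0" using y qnorm_nonneg[of y] qnorm_eq_zero[of y] unfolding p_def coset_eq by simp
    have "\<exists>c. T (coset x) = coset (scaleC_bcontfun c y)" for x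
    proof -
      have "T (coset x) \<in> T ` vcarrier Q" unfolding Q_carrier by blast
      then show ?thesis unfolding T_range Q_scale by blast
    qed
    \<comment> \<open>The coordinate \<open>\<phi>\<close> is chosen on C(G) rather than on cosets;
      \<open>unique\<close> supplies its linearity and its independence of the
      representative.\<close>
    then obtain \<phi> where \<phi>: "\<And>x. T (coset x) = coset (scaleC_bcontfun (\<phi> x) y)" by metis
    have unique: "c = d" if "coset (scaleC_bcontfun c y) = coset (scaleC_bcontfun d y)" for c d
    proof -
      have "qnorm (scaleC_bcontfun (c - d) y) = 0"
        using that unfolding coset_eq qnorm_eq_zero by (simp add: scaleC_bcontfun_simps)
      then show ?thesis using p by (simp add: qnorm_scale p_def)
    qed
    have \<phi>_add: "\<phi> (x + x') = \<phi> x + \<phi> x'" for x x'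
    proof (rule unique)
      have "T (vadd Q (coset x) (coset x')) = vadd Q (T (coset x)) (T (coset x'))"
        using T unfolding bounded_op_def Q_carrier by blast
      then show "coset (scaleC_bcontfun (\<phi> (x + x')) y) = coset (scaleC_bcontfun (\<phi> x + \<phi> x') y)"
        by (simp add: Q_add \<phi> scaleC_bcontfun_simps)
    qed
    have \<phi>_scale: "\<phi> (scaleC_bcontfun c x) = c * \<phi> x" for c x
    proof (rule unique)
      have "T (vscale Q c (coset x)) = vscale Q c (T (coset x))"
        using T unfolding bounded_op_def Q_carrier by blast
      then show "coset (scaleC_bcontfun (\<phi> (scaleC_bcontfun c x)) y) = coset (scaleC_bcontfun (c * \<phi> x) y)"
        by (simp add: Q_scale \<phi> scaleC_bcontfun_simps)
    qed
    have norm_T: "vnorm Q (T (coset x)) = cmod (\<phi> x) * p" for x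
      by (simp add: \<phi> Q_norm qnorm_scale p_def)
    obtain K0 where K0: "\<And>x. vnorm Q (T (coset x)) \<le> K0 * vnorm Q (coset x)"
      using T unfolding bounded_op_def Q_carrier by blast
    define K where "K = \<bar>K0\<bar>"
    have K: "cmod (\<phi> x) * p \<le> K * qnorm x" for x
    proof -
      have "K0 * qnorm x \<le> K * qnorm x" using qnorm_nonneg by (intro mult_right_mono) (auto simp: K_def)
      then show ?thesis using K0[of x] unfolding norm_T Q_norm by linarith
    qed
    have "0 \<le> K" by (simp add: K_def)
    define S where "S = {A \<in> vcarrier Q. vnorm Q A \<le> 1}"
    have S_coset: "coset x \<in> S \<longleftrightarrow> qnorm x \<le> 1" for x
      unfolding S_def Q_carrier by (simp add: Q_norm)
    have S_obtain: "\<exists>x. A = coset x \<and> qnorm x \<le> 1" if "A \<in> S" for A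
      using that unfolding S_def Q_carrier by (auto simp: Q_norm)
    have S_ne: "coset 0 \<in> S" unfolding S_coset using qnorm_le_norm[of 0] by simp
    have bdd: "bdd_above ((\<lambda>A. vnorm Q (T A)) ` S)"
    proof (rule bdd_aboveI2)
      fix A assume "A \<in> S"
      then obtain x where x: "A = coset x" "qnorm x \<le> 1" using S_obtain by blast
      have "cmod (\<phi> x) * p \<le> K * qnorm x" by (rule K)
      also have "\<dots> \<le> K * 1" using x \<open>0 \<le> K\<close> by (intro mult_left_mono)
      finally show "vnorm Q (T A) \<le> K" by (simp add: x norm_T)
    qed
    have N_eq: "N = (SUP A\<in>S. vnorm Q (T A))" unfolding N_def op_norm_def S_def ..
    have N_ge: "cmod (\<phi> x) * p \<le> N" if "qnorm x \<le> 1" for x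
    proof -
      have "vnorm Q (T (coset x)) \<le> N"
        unfolding N_eq using that S_coset by (intro cSUP_upper bdd) auto
      then show ?thesis by (simp add: norm_T)
    qed
    have sum_coset: "vadd Q (coset x) (T (coset x)) = coset (x + scaleC_bcontfun (\<phi> x) y)" for x
      by (simp add: \<phi> Q_add)
    have sum_le: "qnorm (x + scaleC_bcontfun (\<phi> x) y) \<le> 1 + N" if "qnorm x \<le> 1" for x
      using qnorm_triangle[of x "scaleC_bcontfun (\<phi> x) y"] N_ge[OF that] that
      by (simp add: qnorm_scale p_def)
    define N' where "N' = op_norm Q (\<lambda>x. vadd Q x (T x))"
    have N'_eq: "N' = (SUP A\<in>S. vnorm Q (vadd Q A (T A)))" unfolding N'_def op_norm_def S_def ..
    have upper: "vnorm Q (vadd Q A (T A)) \<le> 1 + N" if "A \<in> S" for A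
      using S_obtain[OF that] sum_le by (auto simp: sum_coset Q_norm)
    have "N' \<le> 1 + N"
      unfolding N'_eq using S_ne upper by (intro cSUP_least) auto
    have N'_ge: "qnorm (x + scaleC_bcontfun (\<phi> x) y) \<le> N'" if "qnorm x \<le> 1" for x
    proof -
      have "vnorm Q (vadd Q (coset x) (T (coset x))) \<le> N'"
        unfolding N'_eq using that S_coset upper
        by (intro cSUP_upper bdd_aboveI2[of _ _ "1 + N"]) auto
      then show ?thesis by (simp add: sum_coset Q_norm)
    qed
    \<comment> \<open>Positivity of \<open>N\<close> leaves room for \<open>0 < e < N\<close>, which
      later makes \<open>D\<close> positive. The factor \<open>t\<close> brings \<open>a\<close>
      into the unit ball without dividing by a possibly zero norm.\<close>
    have "N > 0"
    proof -
      have "vscale Q 1 (coset y) \<in> T ` vcarrier Q" unfolding T_range by blast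
      then obtain a where "vscale Q 1 (coset y) = T (coset a)" unfolding Q_carrier by blast
      then have "\<phi> a = 1" using unique[of "\<phi> a" 1] by (simp add: Q_scale \<phi>)
      define t where "t = 1 / (1 + qnorm a)"
      have t: "t > 0" "t * qnorm a \<le> 1" using qnorm_nonneg[of a] by (auto simp: t_def field_simps)
      have "cmod (\<phi> (scaleC_bcontfun (complex_of_real t) a)) * p \<le> N"
        using t by (intro N_ge) (simp add: qnorm_scale)
      then have "t * p \<le> N" using t \<open>\<phi> a = 1\<close> by (simp add: \<phi>_scale)
      then show ?thesis using t(1) p by (metis less_le_trans mult_pos_pos)
    qed
    define \<Phi> where "\<Phi> f = \<phi> (Bcontfun f)" for f :: "'a \<Rightarrow> complex"
    have \<Phi>_apply: "\<Phi> (apply_bcontfun x) = \<phi> x" for x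
      unfolding \<Phi>_def by (simp add: apply_bcontfun_inverse)
    interpret \<Phi>: continuous_functional m \<Phi> "K / p"
    proof
      fix f g :: "'a \<Rightarrow> complex" assume f: "continuous_on UNIV f" and g: "continuous_on UNIV g"
      have "Bcontfun (\<lambda>x. f x + g x) = Bcontfun f + Bcontfun g"
        using f g by (intro bcontfun_eqI) (simp add: Bcontfun_inverse continuous_bcontfun continuous_on_add)
      then show "\<Phi> (\<lambda>x. f x + g x) = \<Phi> f + \<Phi> g" by (simp add: \<Phi>_def \<phi>_add)
    next
      fix f :: "'a \<Rightarrow> complex" and c assume f: "continuous_on UNIV f"
      have "Bcontfun (\<lambda>x. c * f x) = scaleC_bcontfun c (Bcontfun f)"
        using f by (intro bcontfun_eqI) (simp add: Bcontfun_inverse continuous_bcontfun continuous_on_mult_left)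
      then show "\<Phi> (\<lambda>x. c * f x) = c * \<Phi> f" by (simp add: \<Phi>_def \<phi>_scale)
    next
      fix f :: "'a \<Rightarrow> complex" and B assume f: "continuous_on UNIV f" and B: "\<And>x. cmod (f x) \<le> B"
      have "norm (Bcontfun f) \<le> B"
        using f B by (intro norm_bound) (simp add: Bcontfun_inverse continuous_bcontfun)
      then have "qnorm (Bcontfun f) \<le> B" using qnorm_le_norm order_trans by blast
      then have "cmod (\<Phi> f) * p \<le> K * B"
        unfolding \<Phi>_def using K \<open>0 \<le> K\<close> by (meson mult_left_mono order_trans)
      then show "cmod (\<Phi> f) \<le> K / p * B" using p by (simp add: field_simps)
    qed
    \<comment> \<open>One \<open>e\<close> is lost in nearly attaining \<open>N\<close>, the other
      in modifying the representative.\<close>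
    have lower: "1 + N - 2 * e \<le> N'" if e: "0 < e" "e < N" for e
    proof -
      have "\<exists>A\<in>S. N - e < vnorm Q (T A)"
        using less_cSUP_iff[OF _ bdd, of "N - e"] S_ne e(1) unfolding N_eq[symmetric] by auto
      then obtain x1 where x1: "qnorm x1 \<le> 1" "N - e < cmod (\<phi> x1) * p"
        using S_obtain norm_T by metis
      define v where "v = cmod (\<phi> x1) * p"
      \<comment> \<open>This is the midpoint of \<open>(N - e) / v\<close> and 1. Shrinking makes
        the quotient norm strictly less than 1, so a representative in the unit ball exists, while
        the value of \<open>T\<close> stays above \<open>N - e\<close>.\<close>
      define t where "t = (1 + (N - e) / v) / 2"
      have v: "v > 0" "N - e < v" using x1 e by (auto simp: v_def)
      have "(N - e) / v < 1" "0 < (N - e) / v" using v e by simp_all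
      moreover have "t * v = (v + (N - e)) / 2" using v by (simp add: t_def distrib_right)
      ultimately have t: "0 < t" "t < 1" "N - e < t * v" using v by (auto simp: t_def)
      define x2 where "x2 = scaleC_bcontfun (complex_of_real t) x1"
      have "t * qnorm x1 \<le> t * 1" using t x1(1) by (intro mult_left_mono) auto
      then have "t * qnorm x1 < 1" using t by linarith
      then have "qnorm x2 < 1" unfolding x2_def qnorm_scale using t by simp
      then obtain h0 where h0: "h0 \<in> C_spec m \<Lambda>" "norm (x2 + h0) < 1" using qnorm_less by blast
      define x0 where "x0 = x2 + h0"
      have "coset x0 = coset x2" unfolding coset_eq x0_def using h0 by simp
      then have "coset (scaleC_bcontfun (\<phi> x0) y) = coset (scaleC_bcontfun (\<phi> x2) y)"
        unfolding \<phi>[symmetric] by simp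
      then have "\<phi> x0 = \<phi> x2" by (rule unique)
      then have \<phi>0: "cmod (\<phi> x0) * p = t * v"
        using t by (simp add: x2_def \<phi>_scale norm_mult v_def)
      define z where "z = scaleC_bcontfun (\<phi> x0) y"
      define D where "D = t * v"
      have qz: "qnorm z = D" unfolding z_def D_def qnorm_scale p_def[symmetric] by (rule \<phi>0)
      \<comment> \<open>The modification costs \<open>\<epsilon>\<close> in the norm estimate and
        \<open>\<epsilon> * p\<close> through the change of \<open>\<phi>\<close>; together they
        make \<open>e\<close>.\<close>
      define \<epsilon> where "\<epsilon> = e / (1 + p)"
      have \<epsilon>: "\<epsilon> > 0" "\<epsilon> * (1 + p) = e" using e p by (auto simp: \<epsilon>_def)
      obtain x where x: "norm x \<le> 1" "cmod (\<Phi> (apply_bcontfun x) - \<Phi> (apply_bcontfun x0)) \<le> \<epsilon>"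
        and far: "\<And>h. h \<in> C_spec m \<Lambda> \<Longrightarrow> 1 + D - \<epsilon> \<le> norm (x + z + h)"
      proof (rule \<Phi>.modification[OF assms(5), of x0 D z \<epsilon>])
        show "norm x0 \<le> 1" using h0(2) by (simp add: x0_def)
        show "0 < D" using t v by (simp add: D_def)
        show "D \<le> norm (z + h)" if "h \<in> C_spec m \<Lambda>" for h using qnorm_le[OF that, of z] qz by simp
      qed (use \<epsilon> in auto)
      have "1 + D - \<epsilon> \<le> qnorm (x + z)" by (rule qnorm_ge[OF far])
      \<comment> \<open>\<open>modification\<close> keeps \<open>z\<close> built from
        \<open>\<phi> x0\<close>, whereas \<open>T\<close> acts with \<open>\<phi> x\<close>; the
        discrepancy is split off as a small multiple of \<open>y\<close>.\<close>
      also have "x + z = (x + scaleC_bcontfun (\<phi> x) y) + scaleC_bcontfun (\<phi> x0 - \<phi> x) y"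
        by (simp add: z_def scaleC_bcontfun_simps)
      also have "qnorm \<dots> \<le> qnorm (x + scaleC_bcontfun (\<phi> x) y) + qnorm (scaleC_bcontfun (\<phi> x0 - \<phi> x) y)"
        by (rule qnorm_triangle)
      also have "qnorm (scaleC_bcontfun (\<phi> x0 - \<phi> x) y) \<le> \<epsilon> * p"
        unfolding qnorm_scale p_def[symmetric]
        using x(2) p by (intro mult_right_mono) (auto simp: \<Phi>_apply norm_minus_commute)
      also have "qnorm (x + scaleC_bcontfun (\<phi> x) y) \<le> N'"
        using x(1) qnorm_le_norm[of x] by (intro N'_ge) simp
      finally have "1 + D - \<epsilon> \<le> N' + \<epsilon> * p" by simp
      then have "1 + D - \<epsilon> * (1 + p) \<le> N'" by (simp add: algebra_simps)
      then show ?thesis using t(3) \<epsilon>(2) unfolding D_def by linarith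
    qed
    have "1 + N \<le> N'"
    proof (rule field_le_epsilon)
      fix e :: real assume "e > 0"
      define e' where "e' = min (e / 2) (N / 2)"
      have "0 < e'" "e' < N" "2 * e' \<le> e" using \<open>e > 0\<close> \<open>N > 0\<close> by (auto simp: e'_def)
      with lower[of e'] show "1 + N \<le> N' + e" by linarith
    qed
    with \<open>N' \<le> 1 + N\<close> show ?thesis unfolding N_def N'_def by simp
  qed
  then show ?thesis unfolding daugavet_property_def using quotient_banach by blast
qed

end
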